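(* Let $G$ be a Hausdorff locally compact group, let $K$ be a compact subgroup of $\mathrm{Mor}(G)$ with Haar measure $dk$, and let $\mu$ be a complex measure on $G$ with compact support which is $K$-invariant. Let $\delta>0$. Suppose that the continuous functions $f,g:G\to\mathbb{C}$ satisfy the inequality $$\Bigl|\int_{K}\int_{G} f\bigl(x\,t\,(k\cdot y)\bigr)\,d\mu(t)\,dk-f(x)g(y)\Bigr|<\delta\qquad\text{for all }x,y\in G.$$ Then at least one of the following holds: (i) $f$ and $g$ are bounded; or (ii) $f$ is unbounded and $g$ satisfies the functional equation $$\int_{K}\int_{G} g\bigl(x\,t\,(k\cdot y)\bigr)\,d\mu(t)\,dk+\int_{K}\int_{G} g\bigl((k\cdot y)\,t\,x\bigr)\,d\mu(t)\,dk=2g(x)g(y),\qquad x,y\in G;\tag{E}$$ or (iii) $g$ is unbounded, $f$ satisfies $$\int_{G}\int_{K} f\bigl(x\,t\,(k\cdot y)\bigr)\,dk\,d\mu(t)=f(x)g(y),\qquad x,y\in G,$$ and, if $f\neq 0$, then $g$ satisfies equation (E).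
   Context: $G$ is not assumed abelian. $\mathrm{Mor}(G)$ is the group (under composition) of all maps $k:G\to G$ that are homeomorphisms of $G$ onto itself and are either group automorphisms or group antiautomorphisms ($k(xy)=k(y)k(x)$). The action of $k\in K$ on $x\in G$ is written $k\cdot x$. The compact group $K$ acts continuously on $G$ (the map $K\times G\to G$, $(k,x)\mapsto k\cdot x$, is continuous), and $dk$ is the normalized Haar measure on $K$ (total mass $1$). A complex measure means a bounded complex (regular Borel) measure on $G$. The measure $\mu$ is $K$-invariant if $\int_G f(k\cdot t)\,d\mu(t)=\int_G f(t)\,d\mu(t)$ for all $k\in K$ and all continuous $f:G\to\mathbb{C}$. "$f\ne 0$" means that $f$ is not identically zero. *)

theory Defs
  imports "HOL-Analysis.Analysis" "HOL-Algebra.Group"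
begin

text \<open>
  The group \<open>G\<close> is a type of class \<open>{topological_group_add, t2_space}\<close>. Its operation is
  written additively because the library's class of topological groups is additive;
  \<open>group_add\<close> does not assume commutativity. So the product \<open>x t (k\<cdot>y)\<close> appears as
  \<open>x + t + k y\<close>, and the order of the summands matters.
\<close>

section \<open>The group of homeomorphic automorphisms and antiautomorphisms\<close>

definition Mor :: "('a::topological_group_add \<Rightarrow> 'a) monoid" where
  "Mor = \<lparr>carrier = {k. homeomorphic_map euclidean euclidean k \<and>
                        ((\<forall>x y. k (x + y) = k x + k y) \<or> (\<forall>x y. k (x + y) = k y + k x))},
          mult = (\<circ>), one = id\<rparr>"

lemma Mor_inv_closed:
  assumes "k \<in> carrier (Mor :: ('a::topological_group_add \<Rightarrow> 'a) monoid)"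
  shows "inv_into UNIV k \<in> carrier (Mor :: ('a \<Rightarrow> 'a) monoid)"
    and "inv_into UNIV k \<circ> k = id"
proof -
  have h: "homeomorphic_map euclidean euclidean k"
    using assms by (simp add: Mor_def)
  have b: "bij k"
    using homeomorphic_imp_injective_map[OF h] homeomorphic_imp_surjective_map[OF h]
    by (simp add: bij_betw_def)
  obtain g where g: "homeomorphic_maps euclidean euclidean k g"
    using h homeomorphic_map_maps by blast
  then have "k (g y) = y" for y
    by (simp add: homeomorphic_maps_def)
  then have eq: "inv_into UNIV k = g"
    using b by (metis bij_is_inj ext inv_f_f)
  have "homeomorphic_map euclidean euclidean (inv_into UNIV k)"
    unfolding eq using g homeomorphic_maps_sym homeomorphic_map_maps by blast
  moreover have "inv_into UNIV k (x + y) = inv_into UNIV k x + inv_into UNIV k y"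
    if "\<forall>x y. k (x + y) = k x + k y" for x y
    by (metis b bij_inv_eq_iff that)
  moreover have "inv_into UNIV k (x + y) = inv_into UNIV k y + inv_into UNIV k x"
    if "\<forall>x y. k (x + y) = k y + k x" for x y
    by (metis b bij_inv_eq_iff that)
  ultimately show "inv_into UNIV k \<in> carrier (Mor :: ('a \<Rightarrow> 'a) monoid)"
    using assms unfolding Mor_def by auto
  show "inv_into UNIV k \<circ> k = id"
    using b by (simp add: bij_is_inj)
qed

lemma group_Mor: "group (Mor :: ('a::topological_group_add \<Rightarrow> 'a) monoid)"
proof (rule groupI)
  show "\<one>\<^bsub>Mor\<^esub> \<in> carrier (Mor :: ('a \<Rightarrow> 'a) monoid)"
    by (simp add: Mor_def homeomorphic_map_id)
  fix h k :: "'a \<Rightarrow> 'a"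
  assume "h \<in> carrier Mor" "k \<in> carrier Mor"
  then show "h \<otimes>\<^bsub>Mor\<^esub> k \<in> carrier Mor"
    using homeomorphic_map_compose[of euclidean euclidean k euclidean h]
    by (auto simp: Mor_def)
next
  fix k :: "'a \<Rightarrow> 'a" assume "k \<in> carrier Mor"
  then show "\<exists>l\<in>carrier Mor. l \<otimes>\<^bsub>Mor\<^esub> k = \<one>\<^bsub>Mor\<^esub>"
    using Mor_inv_closed by (intro bexI[of _ "inv_into UNIV k"]) (auto simp: Mor_def)
qed (auto simp: Mor_def comp_assoc)

section \<open>Regularity, compact groups and Haar measure\<close>

definition borel_sets :: "'b topology \<Rightarrow> 'b set set" where
  "borel_sets T = sigma_sets (topspace T) {U. openin T U}"

lemma borel_sets_euclidean: "borel_sets euclidean = sets borel"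
  by (simp add: borel_sets_def borel_def)

definition regular :: "'b topology \<Rightarrow> ('b set \<Rightarrow> ennreal) \<Rightarrow> bool" where
  "regular T m \<longleftrightarrow>
     (\<forall>A\<in>borel_sets T.
        m A = (INF U\<in>{U. openin T U \<and> A \<subseteq> U}. m U) \<and>
        m A = (SUP C\<in>{C. compactin T C \<and> C \<subseteq> A}. m C))"

text \<open>
  A group \<open>K\<close> of maps is made a compact group by a topology \<open>T\<close> with \<open>topspace T = K\<close>. If the
  action on a Hausdorff space is jointly continuous, then \<open>T\<close> is unique: the map from \<open>T\<close> to the
  compact-open topology on \<open>K\<close> is a continuous bijection from a compact onto a Hausdorff space.
\<close>

definition compact_group :: "('b, 'c) monoid_scheme \<Rightarrow> 'b topology \<Rightarrow> bool" where
  "compact_group G T \<longleftrightarrow>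
     group G \<and> topspace T = carrier G \<and> compact_space T \<and> Hausdorff_space T \<and>
     continuous_map (prod_topology T T) T (\<lambda>(x, y). x \<otimes>\<^bsub>G\<^esub> y) \<and>
     continuous_map T T (m_inv G)"

definition normalized_haar_measure ::
  "('b, 'c) monoid_scheme \<Rightarrow> 'b topology \<Rightarrow> 'b measure \<Rightarrow> bool" where
  "normalized_haar_measure G T \<kappa> \<longleftrightarrow>
     space \<kappa> = carrier G \<and> sets \<kappa> = borel_sets T \<and>
     regular T (emeasure \<kappa>) \<and>
     (\<forall>g\<in>carrier G. \<forall>A\<in>sets \<kappa>. emeasure \<kappa> ((\<lambda>x. g \<otimes>\<^bsub>G\<^esub> x) ` A) = emeasure \<kappa> A) \<and>
     emeasure \<kappa> (space \<kappa>) = 1"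

section \<open>Complex measures\<close>

text \<open>
  Countable additivity already implies boundedness. It is listed because a complex measure is by
  convention a bounded one.
\<close>

definition total_variation :: "('a::topological_space set \<Rightarrow> complex) \<Rightarrow> 'a set \<Rightarrow> ennreal" where
  "total_variation \<mu> A =
     (SUP P\<in>{P. finite P \<and> P \<subseteq> sets borel \<and> partition_on A P}. \<Sum>B\<in>P. ennreal (norm (\<mu> B)))"

definition complex_measure :: "('a::topological_space set \<Rightarrow> complex) \<Rightarrow> bool" where
  "complex_measure \<mu> \<longleftrightarrow>
     (\<forall>A. range A \<subseteq> sets borel \<and> disjoint_family A \<longrightarrow> (\<lambda>i::nat. \<mu> (A i)) sums \<mu> (\<Union>i. A i)) \<and>
     bounded (\<mu> ` sets borel) \<and>
     regular euclidean (total_variation \<mu>)"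

definition measure_support :: "('a::topological_space set \<Rightarrow> complex) \<Rightarrow> 'a set" where
  "measure_support \<mu> = {x. \<forall>U. open U \<and> x \<in> U \<longrightarrow> total_variation \<mu> U \<noteq> 0}"

text \<open>
  For a real signed measure \<open>\<nu>\<close>, \<open>upper_variation \<nu>\<close> and \<open>upper_variation (- \<nu>)\<close> are the two parts
  of its Jordan decomposition. The integral with respect to a complex measure is defined by
  decomposing its real and imaginary parts in this way.
\<close>

definition upper_variation :: "('a::topological_space set \<Rightarrow> real) \<Rightarrow> 'a measure" where
  "upper_variation \<nu> =
     measure_of UNIV (sets borel) (\<lambda>A. SUP B\<in>{B \<in> sets borel. B \<subseteq> A}. ennreal (\<nu> B))"

lemma emeasure_upper_variation:
  assumes ca: "\<And>A. range A \<subseteq> sets borel \<Longrightarrow> disjoint_family A \<Longrightarrow> (\<lambda>i::nat. \<nu> (A i)) sums \<nu> (\<Union>i. A i)"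
    and A: "A \<in> sets (borel :: 'a::topological_space measure)"
  shows "emeasure (upper_variation \<nu>) A = (SUP B\<in>{B \<in> sets borel. B \<subseteq> A}. ennreal (\<nu> B))"
proof -
  let ?m = "\<lambda>A. SUP B\<in>{B \<in> sets borel. B \<subseteq> A}. ennreal (\<nu> B)"
  have "(\<lambda>i::nat. \<nu> {}) sums \<nu> {}"
    using ca[of "\<lambda>_. {}"] by (simp add: disjoint_family_on_def)
  then have e: "\<nu> {} = 0"
    using summable_const_iff sums_summable by blast
  have pos: "positive (sets borel) ?m"
  proof -
    have "{B \<in> sets borel. B \<subseteq> {}} = {{}::'a set}" by auto
    then show ?thesis by (simp add: positive_def e)
  qed
  have add: "\<nu> (B \<union> C) = \<nu> B + \<nu> C" if "B \<in> sets borel" "C \<in> sets borel" "B \<inter> C = {}" for B C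
  proof -
    have "(\<lambda>i. \<nu> (binaryset B C i)) sums \<nu> (\<Union>i. binaryset B C i)"
      using that by (intro ca) (auto simp: binaryset_def disjoint_family_on_def)
    moreover have "(\<lambda>i. \<nu> (binaryset B C i)) sums (\<nu> B + \<nu> C)"
      using binaryset_sums[of \<nu> B C] e by simp
    ultimately show ?thesis by (simp add: UN_binaryset_eq sums_unique2)
  qed
  have sup_add: "?m (X \<union> Y) \<ge> ?m X + ?m Y"
    if X: "X \<in> sets borel" and Y: "Y \<in> sets borel" and d: "X \<inter> Y = {}" for X Y
  proof -
    have "ennreal (\<nu> B) + ennreal (\<nu> C) \<le> ?m (X \<union> Y)"
      if "B \<in> sets borel" "B \<subseteq> X" "C \<in> sets borel" "C \<subseteq> Y" for B C
    proof -
      have 0: "ennreal (\<nu> D) \<le> ?m (X \<union> Y)" if "D \<in> sets borel" "D \<subseteq> X \<union> Y" for D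
        using that by (intro SUP_upper) auto
      consider "\<nu> B \<le> 0" | "\<nu> C \<le> 0" | "\<nu> B \<ge> 0" "\<nu> C \<ge> 0" by linarith
      then show ?thesis
      proof cases
        case 1 then show ?thesis using 0[of C] that by (auto simp: ennreal_neg)
      next
        case 2 then show ?thesis using 0[of B] that by (auto simp: ennreal_neg)
      next
        case 3
        have "B \<inter> C = {}" "B \<union> C \<subseteq> X \<union> Y" using that d by auto
        then show ?thesis using 3 0[of "B \<union> C"] that add[of B C]
          by (simp add: ennreal_plus[symmetric] sets.Un del: ennreal_plus)
      qed
    qed
    then have "ennreal (\<nu> B) + ?m Y \<le> ?m (X \<union> Y)" if "B \<in> sets borel" "B \<subseteq> X" for B
      using that by (subst ennreal_SUP_add_right) (auto intro!: SUP_least)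
    then show ?thesis
      by (subst ennreal_SUP_add_left[symmetric]) (auto intro!: SUP_least)
  qed
  have mono: "?m X \<le> ?m Y" if "X \<subseteq> Y" for X Y
    using that by (intro SUP_subset_mono) auto
  have "countably_additive (sets borel) ?m"
    unfolding countably_additive_def
  proof (intro allI impI antisym)
    fix X :: "nat \<Rightarrow> 'a set"
    assume X: "range X \<subseteq> sets borel" and d: "disjoint_family X"
    have XB: "X i \<in> sets borel" for i using X by auto
    have "(\<Sum>i<n. ?m (X i)) \<le> ?m (\<Union>i<n. X i)" for n
    proof (induction n)
      case (Suc n)
      have "(\<Sum>i<Suc n. ?m (X i)) \<le> ?m (\<Union>i<n. X i) + ?m (X n)"
        using Suc by (simp add: add_right_mono)
      also have "\<dots> \<le> ?m ((\<Union>i<n. X i) \<union> X n)"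
      proof (rule sup_add)
        show "(\<Union>i<n. X i) \<inter> X n = {}"
        proof -
          have "X i \<inter> X n = {}" if "i < n" for i
            using d that by (intro disjoint_family_onD[of X UNIV]) auto
          then show ?thesis by blast
        qed
      qed (use XB in auto)
      finally show ?case by (simp add: lessThan_Suc Un_commute)
    qed simp
    then have "(\<Sum>i<n. ?m (X i)) \<le> ?m (\<Union>i. X i)" for n
      by (rule order_trans) (intro mono, auto)
    then show "(\<Sum>i. ?m (X i)) \<le> ?m (\<Union>i. X i)"
      by (intro suminf_le_const summableI) auto
    show "?m (\<Union>i. X i) \<le> (\<Sum>i. ?m (X i))"
    proof (rule SUP_least, clarify)
      fix B :: "'a set" assume B: "B \<in> sets borel" "B \<subseteq> (\<Union>i. X i)"
      have "(\<lambda>i. \<nu> (B \<inter> X i)) sums \<nu> (\<Union>i. B \<inter> X i)"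
        using B d XB by (intro ca) (auto simp: disjoint_family_on_def)
      moreover have "(\<Union>i. B \<inter> X i) = B" using B by auto
      ultimately have s: "(\<lambda>n. \<Sum>i<n. \<nu> (B \<inter> X i)) \<longlonglongrightarrow> \<nu> B" by (simp add: sums_def)
      have "ennreal (\<Sum>i<n. \<nu> (B \<inter> X i)) \<le> (\<Sum>i. ?m (X i))" for n
      proof -
        have "ennreal (\<Sum>i<n. \<nu> (B \<inter> X i)) \<le> ennreal (\<Sum>i<n. max 0 (\<nu> (B \<inter> X i)))"
          by (intro ennreal_leI sum_mono) auto
        also have "\<dots> = (\<Sum>i<n. ennreal (max 0 (\<nu> (B \<inter> X i))))"
          by (simp add: sum_ennreal)
        also have "\<dots> \<le> (\<Sum>i<n. ?m (X i))"
        proof (rule sum_mono)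
          fix i
          have "ennreal (\<nu> (B \<inter> X i)) \<le> ?m (X i)"
            using B(1) XB by (intro SUP_upper) blast
          then show "ennreal (max 0 (\<nu> (B \<inter> X i))) \<le> ?m (X i)"
            by (cases "\<nu> (B \<inter> X i) \<le> 0") (simp_all add: max_def)
        qed
        also have "\<dots> \<le> (\<Sum>i. ?m (X i))" by (intro sum_le_suminf summableI) auto
        finally show ?thesis .
      qed
      with tendsto_ennrealI[OF s] show "ennreal (\<nu> B) \<le> (\<Sum>i. ?m (X i))"
        by (intro LIMSEQ_le_const2) auto
    qed
  qed
  with pos show ?thesis
    unfolding upper_variation_def
    using A sets.sigma_algebra_axioms[of "borel :: 'a measure"]
    by (simp add: emeasure_measure_of_sigma)
qed

definition cm_integral ::
  "('a::topological_space set \<Rightarrow> complex) \<Rightarrow> ('a \<Rightarrow> complex) \<Rightarrow> complex" where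
  "cm_integral \<mu> f =
     (LINT t|upper_variation (\<lambda>A. Re (\<mu> A)). f t) - (LINT t|upper_variation (\<lambda>A. - Re (\<mu> A)). f t)
     + \<i> * ((LINT t|upper_variation (\<lambda>A. Im (\<mu> A)). f t)
            - (LINT t|upper_variation (\<lambda>A. - Im (\<mu> A)). f t))"

definition K_invariant ::
  "('a::topological_space \<Rightarrow> 'a) set \<Rightarrow> ('a set \<Rightarrow> complex) \<Rightarrow> bool" where
  "K_invariant K \<mu> \<longleftrightarrow>
     (\<forall>k\<in>K. \<forall>f::'a \<Rightarrow> complex. continuous_on UNIV f \<longrightarrow>
        cm_integral \<mu> (\<lambda>t. f (k t)) = cm_integral \<mu> f)"

section \<open>The functional equation (E)\<close>

definition equation_E ::
  "('a::topological_group_add \<Rightarrow> 'a) measure \<Rightarrow> ('a set \<Rightarrow> complex) \<Rightarrow> ('a \<Rightarrow> complex) \<Rightarrow> bool" where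
  "equation_E \<kappa> \<mu> g \<longleftrightarrow>
     (\<forall>x y. (LINT k|\<kappa>. cm_integral \<mu> (\<lambda>t. g (x + t + k y)))
          + (LINT k|\<kappa>. cm_integral \<mu> (\<lambda>t. g (k y + t + x))) = 2 * g x * g y)"

end

theory Submission
  imports Defs
begin

text \<open>
  Write \<open>average f x y\<close> for the double integral of \<open>f (x + t + k y)\<close> and consider, for fixed
  \<open>x\<close>, \<open>y\<close> and variable \<open>w\<close>, the integral over \<open>(k, t)\<close> of
  \<open>average f w (x + t + k y) + average f w (k y + t + x)\<close>. It contains an inner integral over
  \<open>(k', s)\<close> of \<open>f (w + s + k' (x + t + k y)) + f (w + s + k' (k y + t + x))\<close>. Whether \<open>k'\<close> is an
  automorphism or an antiautomorphism, it produces the same two summands, up to their order, so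
  the symmetric sum does not see the difference. After a change in the order of
  integration the invariance of \<open>\<mu>\<close> and of Haar measure absorbs \<open>k'\<close> from \<open>k' t\<close> and
  \<open>k' \<circ> k\<close>. The result is the exact identity \<open>average_symmetrised\<close>, both of whose sides
  are integrals of averages of \<open>f\<close>.

  Now let \<open>average f x y\<close> be within \<open>\<delta>\<close> of \<open>f x * g y\<close> throughout. The left-hand side of the
  identity is then \<open>f w\<close> times the left-hand side of (E), and the right-hand side is
  \<open>f w * (2 * g x * g y)\<close>, each up to an error that does not depend on \<open>w\<close>. If \<open>f\<close> is
  unbounded, dividing by \<open>f w\<close> yields (E) exactly (\<open>equation_of_unbounded\<close>).
  If \<open>f\<close> is bounded and not zero, then \<open>f x * g y\<close> is bounded in \<open>y\<close> for a point \<open>x\<close> with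
  \<open>f x \<noteq> 0\<close>, so \<open>g\<close> is bounded (\<open>bounded_factor\<close>). If \<open>f = 0\<close>, the equation for \<open>f\<close> in the last
  alternative is trivial.

  The analytic part consists in justifying the changes of the order of integration. The compact
  group and the support of \<open>\<mu>\<close> need not have countable bases, so the integrals are treated as
  bounded functionals on continuous functions on compact spaces; for these, order of
  application is immaterial (\<open>bounded_functional_Fubini\<close>). That \<open>\<mu>\<close> gives such a functional rests on
  its regularity, which makes it vanish outside its support
  (\<open>complex_measure_zero_outside_support\<close>).
\<close>

section \<open>Bounded functionals on continuous functions\<close>

text \<open>
  The integrals in the theorem are used only through their values on continuous functions on a
  compact space, so they are treated as bounded linear functionals there. The point of doing so is
  \<open>bounded_functional_Fubini\<close>: when the spaces have no countable bases, a continuous function of two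
  variables may fail to be measurable for the product \<open>\<sigma>\<close>-algebra, so Fubini's theorem for product
  measures does not apply, whereas bounded functionals on continuous functions always commute.

  The number \<open>B\<close> is any bound of the norm. A continuous map is a total function here, but the last
  clause makes \<open>L\<close> depend on its values on \<open>topspace X\<close> only.
\<close>

definition bounded_functional :: "'b topology \<Rightarrow> real \<Rightarrow> (('b \<Rightarrow> complex) \<Rightarrow> complex) \<Rightarrow> bool" where
  "bounded_functional X B L \<longleftrightarrow>
     (\<forall>\<phi> \<psi>. continuous_map X euclidean \<phi> \<longrightarrow> continuous_map X euclidean \<psi> \<longrightarrow>
        L (\<lambda>x. \<phi> x + \<psi> x) = L \<phi> + L \<psi>) \<and>
     (\<forall>c \<phi>. continuous_map X euclidean \<phi> \<longrightarrow> L (\<lambda>x. c * \<phi> x) = c * L \<phi>) \<and>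
     0 \<le> B \<and> (\<forall>\<phi> b. continuous_map X euclidean \<phi> \<longrightarrow> 0 \<le> b \<longrightarrow>
        (\<forall>x\<in>topspace X. norm (\<phi> x) \<le> b) \<longrightarrow> norm (L \<phi>) \<le> B * b)"

lemma bounded_functional_add:
  assumes "bounded_functional X B L" "continuous_map X euclidean \<phi>" "continuous_map X euclidean \<psi>"
  shows "L (\<lambda>x. \<phi> x + \<psi> x) = L \<phi> + L \<psi>"
  using assms unfolding bounded_functional_def by blast

lemma bounded_functional_mult_left:
  assumes "bounded_functional X B L" "continuous_map X euclidean \<phi>"
  shows "L (\<lambda>x. c * \<phi> x) = c * L \<phi>"
  using assms unfolding bounded_functional_def by blast

lemma bounded_functional_mult_right:
  assumes "bounded_functional X B L" "continuous_map X euclidean \<phi>"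
  shows "L (\<lambda>x. \<phi> x * c) = L \<phi> * c"
  using bounded_functional_mult_left[OF assms, of c] by (simp add: mult.commute)

lemma bounded_functional_diff:
  assumes L: "bounded_functional X B L"
    and \<phi>: "continuous_map X euclidean \<phi>" and \<psi>: "continuous_map X euclidean \<psi>"
  shows "L (\<lambda>x. \<phi> x - \<psi> x) = L \<phi> - L \<psi>"
proof -
  have m: "continuous_map X euclidean (\<lambda>x. (-1) * \<psi> x)"
    using continuous_map_minus[OF \<psi>] by simp
  show ?thesis
    using bounded_functional_add[OF L \<phi> m] bounded_functional_mult_left[OF L \<psi>, of "-1"] by simp
qed

lemma bounded_functional_sum:
  assumes L: "bounded_functional X B L" and J: "finite J"
    and \<phi>: "\<And>j. j \<in> J \<Longrightarrow> continuous_map X euclidean (\<phi> j)"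
  shows "L (\<lambda>x. \<Sum>j\<in>J. \<phi> j x * c j) = (\<Sum>j\<in>J. L (\<phi> j) * c j)"
  using J \<phi>
proof (induction J rule: finite_induct)
  case empty
  show ?case using bounded_functional_mult_left[OF L, of "\<lambda>_. 0" 0] by simp
next
  case (insert i J)
  have m: "continuous_map X euclidean (\<lambda>x. \<phi> j x * c j)" if "j \<in> insert i J" for j
    using insert.prems[OF that] by (simp add: continuous_map_atin tendsto_mult_right)
  have s: "continuous_map X euclidean (\<lambda>x. \<Sum>j\<in>J. \<phi> j x * c j)"
    by (intro continuous_map_sum insert.hyps m insertI2)
  have "L (\<lambda>x. \<Sum>j\<in>insert i J. \<phi> j x * c j) = L (\<lambda>x. \<phi> i x * c i + (\<Sum>j\<in>J. \<phi> j x * c j))"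
    using insert.hyps by simp
  also have "\<dots> = L (\<lambda>x. \<phi> i x * c i) + L (\<lambda>x. \<Sum>j\<in>J. \<phi> j x * c j)"
    by (rule bounded_functional_add[OF L m s]) simp
  also have "L (\<lambda>x. \<phi> i x * c i) = L (\<phi> i) * c i"
    by (rule bounded_functional_mult_right[OF L insert.prems]) simp
  also have "L (\<lambda>x. \<Sum>j\<in>J. \<phi> j x * c j) = (\<Sum>j\<in>J. L (\<phi> j) * c j)"
    by (rule insert.IH) (simp add: insert.prems)
  finally show ?case using insert.hyps by simp
qed

lemma bounded_functional_nonneg: "bounded_functional X B L \<Longrightarrow> 0 \<le> B"
  by (simp add: bounded_functional_def)

lemma bounded_functional_bound:
  assumes "bounded_functional X B L" "continuous_map X euclidean \<phi>" "0 \<le> b"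
    and "\<And>x. x \<in> topspace X \<Longrightarrow> norm (\<phi> x) \<le> b"
  shows "norm (L \<phi>) \<le> B * b"
  using assms unfolding bounded_functional_def by blast

lemma bounded_functional_dist:
  assumes L: "bounded_functional X B L"
    and c: "continuous_map X euclidean \<phi>" "continuous_map X euclidean \<psi>" and b: "0 \<le> b"
    and le: "\<And>x. x \<in> topspace X \<Longrightarrow> norm (\<phi> x - \<psi> x) \<le> b"
  shows "norm (L \<phi> - L \<psi>) \<le> B * b"
  unfolding bounded_functional_diff[OF L c, symmetric]
  by (rule bounded_functional_bound[OF L continuous_map_diff[OF c] b le])

lemma bounded_functional_cong:
  assumes L: "bounded_functional X B L"
    and c: "continuous_map X euclidean \<phi>" "continuous_map X euclidean \<psi>"
    and eq: "\<And>x. x \<in> topspace X \<Longrightarrow> \<phi> x = \<psi> x"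
  shows "L \<phi> = L \<psi>"
proof -
  have "norm (L \<phi> - L \<psi>) \<le> B * 0"
    by (rule bounded_functional_dist[OF L c]) (simp_all add: eq)
  then show ?thesis by simp
qed

lemma continuous_map_section:
  assumes "continuous_map (prod_topology Z X) W h" "z \<in> topspace Z"
  shows "continuous_map X W (\<lambda>x. h (z, x))"
  using continuous_map_compose[OF _ assms(1), of X "\<lambda>x. (z, x)"] assms(2)
  by (simp add: o_def continuous_map_pairedI)

lemma continuous_map_section_fst:
  assumes "continuous_map (prod_topology X Y) W h" "y \<in> topspace Y"
  shows "continuous_map X W (\<lambda>x. h (x, y))"
  using continuous_map_compose[OF _ assms(1), of X "\<lambda>x. (x, y)"] assms(2)
  by (simp add: o_def continuous_map_pairedI)

lemma continuous_map_swap: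
  assumes "continuous_map (prod_topology X Y) W h"
  shows "continuous_map (prod_topology Y X) W (\<lambda>(y, x). h (x, y))"
  using continuous_map_compose[OF _ assms, of "prod_topology Y X" "\<lambda>(y, x). (x, y)"]
  by (simp add: o_def case_prod_unfold continuous_map_pairedI continuous_map_fst continuous_map_snd)

text \<open>
  Compactness of \<open>X\<close> makes the family \<open>h (u, -)\<close> continuous in \<open>u\<close> for the supremum norm,
  by the tube lemma applied to the open set of pairs at which \<open>h\<close> differs from
  \<open>h (z, -)\<close> by less than \<open>e\<close>.
\<close>

lemma uniform_nbhd:
  fixes h :: "'c \<times> 'b \<Rightarrow> complex"
  assumes X: "compact_space X" and h: "continuous_map (prod_topology Z X) euclidean h"
    and z: "z \<in> topspace Z" and e: "0 < e"
  shows "\<exists>U. openin Z U \<and> z \<in> U \<and> (\<forall>u\<in>U. \<forall>x\<in>topspace X. norm (h (u, x) - h (z, x)) < e)"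
proof -
  let ?W = "{p \<in> topspace (prod_topology Z X). norm (h p - h (z, snd p)) \<in> {..<e}}"
  have "continuous_map (prod_topology Z X) euclidean ((\<lambda>x. h (z, x)) \<circ> snd)"
    by (intro continuous_map_compose[OF continuous_map_snd] continuous_map_section[OF h z])
  then have "continuous_map (prod_topology Z X) euclidean (\<lambda>p. norm (h p - h (z, snd p)))"
    using h by (intro continuous_map_norm continuous_map_diff) (simp_all add: o_def)
  then have W: "openin (prod_topology Z X) ?W"
    by (rule openin_continuous_map_preimage) simp
  moreover have "{z} \<times> topspace X \<subseteq> ?W" using z e by auto
  moreover have "compactin X (topspace X)" using X by (simp add: compact_space_def)
  ultimately obtain U V where UV: "openin Z U" "z \<in> U" "topspace X \<subseteq> V" "U \<times> V \<subseteq> ?W"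
    using tube_lemma_right[of Z X ?W "topspace X" z] z by auto
  have "norm (h (u, x) - h (z, x)) < e" if "u \<in> U" "x \<in> topspace X" for u x
  proof -
    have "(u, x) \<in> ?W" using UV that by blast
    then show ?thesis by simp
  qed
  with UV show ?thesis by blast
qed

lemma continuous_map_bounded_functional:
  assumes X: "compact_space X" and L: "bounded_functional X B L"
    and h: "continuous_map (prod_topology Z X) euclidean h"
  shows "continuous_map Z euclidean (\<lambda>z. L (\<lambda>x. h (z, x)))"
  unfolding continuous_map_atin limitin_canonical_iff
proof (intro ballI tendstoI)
  fix z e assume z: "z \<in> topspace Z" and e: "0 < (e::real)"
  note B = bounded_functional_nonneg[OF L] bounded_functional_dist[OF L]
  define d where "d = e / (B + 1)"
  have d: "0 < d" "B * d < e" using e B(1) by (auto simp: d_def field_simps)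
  obtain U where U: "openin Z U" "z \<in> U" "\<forall>u\<in>U. \<forall>x\<in>topspace X. norm (h (u, x) - h (z, x)) < d"
    using uniform_nbhd[OF X h z d(1)] by blast
  have "dist (L (\<lambda>x. h (u, x))) (L (\<lambda>x. h (z, x))) < e" if "u \<in> U" for u
  proof -
    have "u \<in> topspace Z" using U that openin_subset by blast
    then have "norm (L (\<lambda>x. h (u, x)) - L (\<lambda>x. h (z, x))) \<le> B * d"
      using U that z d by (intro B(2) continuous_map_section[OF h]) (auto intro: less_imp_le)
    then show ?thesis using d by (simp add: dist_norm)
  qed
  then show "\<forall>\<^sub>F u in atin Z z. dist (L (\<lambda>x. h (u, x))) (L (\<lambda>x. h (z, x))) < e"
    using U by (auto simp: eventually_atin)
qed

text \<open>
  The iterated functional is again bounded because the inner one produces a continuous function of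
  \<open>x\<close>. This lets a double integral be treated as one functional.
\<close>

lemma bounded_functional_prod:
  assumes X: "compact_space X" and Y: "compact_space Y"
    and L: "bounded_functional X B L" and M: "bounded_functional Y C M"
  shows "bounded_functional (prod_topology X Y) (B * C) (\<lambda>\<phi>. L (\<lambda>x. M (\<lambda>y. \<phi> (x, y))))"
  unfolding bounded_functional_def
proof (intro conjI allI impI)
  let ?XY = "prod_topology X Y"
  note cont = continuous_map_bounded_functional[OF Y M]
  fix \<phi> :: "_ \<Rightarrow> complex" assume \<phi>: "continuous_map ?XY euclidean \<phi>"
  {
    fix \<psi> :: "_ \<Rightarrow> complex" assume \<psi>: "continuous_map ?XY euclidean \<psi>"
    have "L (\<lambda>x. M (\<lambda>y. \<phi> (x, y) + \<psi> (x, y))) = L (\<lambda>x. M (\<lambda>y. \<phi> (x, y)) + M (\<lambda>y. \<psi> (x, y)))"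
      by (intro bounded_functional_cong[OF L] cont[of _ "\<lambda>z. \<phi> z + \<psi> z"] continuous_map_add \<phi> \<psi>
          cont bounded_functional_add[OF M] continuous_map_section[OF \<phi>] continuous_map_section[OF \<psi>])
    also have "\<dots> = L (\<lambda>x. M (\<lambda>y. \<phi> (x, y))) + L (\<lambda>x. M (\<lambda>y. \<psi> (x, y)))"
      by (intro bounded_functional_add[OF L] cont \<phi> \<psi>)
    finally show "L (\<lambda>x. M (\<lambda>y. \<phi> (x, y) + \<psi> (x, y))) = \<dots>" .
  }
  {
    fix c
    have m: "continuous_map X euclidean (\<lambda>x. c * \<rho> x)" if "continuous_map X euclidean \<rho>"
      for \<rho> :: "_ \<Rightarrow> complex" and X
      using that by (simp add: continuous_map_atin tendsto_mult_left)
    have "L (\<lambda>x. M (\<lambda>y. c * \<phi> (x, y))) = L (\<lambda>x. c * M (\<lambda>y. \<phi> (x, y)))"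
      by (intro bounded_functional_cong[OF L] cont[of _ "\<lambda>z. c * \<phi> z"] m \<phi> cont
          bounded_functional_mult_left[OF M] continuous_map_section[OF \<phi>])
    also have "\<dots> = c * L (\<lambda>x. M (\<lambda>y. \<phi> (x, y)))"
      by (intro bounded_functional_mult_left[OF L] cont \<phi>)
    finally show "L (\<lambda>x. M (\<lambda>y. c * \<phi> (x, y))) = \<dots>" .
  }
next
  note B = bounded_functional_nonneg[OF L] bounded_functional_bound[OF L]
  note C = bounded_functional_nonneg[OF M] bounded_functional_bound[OF M]
  show "0 \<le> B * C" using B(1) C(1) by simp
  fix \<phi> :: "_ \<Rightarrow> complex" and b :: real
  assume \<phi>: "continuous_map (prod_topology X Y) euclidean \<phi>" and b: "0 \<le> b"
    and le: "\<forall>z\<in>topspace (prod_topology X Y). norm (\<phi> z) \<le> b"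
  have "norm (L (\<lambda>x. M (\<lambda>y. \<phi> (x, y)))) \<le> B * (C * b)"
    using b C(1) le
    by (intro B(2) C(2) continuous_map_bounded_functional[OF Y M \<phi>] continuous_map_section[OF \<phi>])
      auto
  then show "norm (L (\<lambda>x. M (\<lambda>y. \<phi> (x, y)))) \<le> B * C * b" by (simp add: mult.assoc)
qed

text \<open>
  Functions of the form \<open>\<Sum>j. u j x * \<psi> j y\<close> are uniformly dense. A partition of unity
  \<open>\<psi>\<close> on \<open>Y\<close>, subordinate to a finite cover by sets on which \<open>h (x, y)\<close> hardly depends on
  \<open>y\<close>, makes every \<open>h (x, y)\<close> close to an average of the values \<open>h (x, j)\<close> at the centres
  \<open>j\<close> of the sets. Complete regularity of \<open>Y\<close> supplies the bump functions.
\<close>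

lemma separated_approximation:
  fixes h :: "'b \<times> 'c \<Rightarrow> complex"
  assumes X: "compact_space X" and Y: "compact_space Y" "Hausdorff_space Y"
    and h: "continuous_map (prod_topology X Y) euclidean h" and e: "0 < e"
  obtains J and \<psi> :: "'c \<Rightarrow> 'c \<Rightarrow> complex"
  where "finite J" "J \<subseteq> topspace Y" "\<And>j. j \<in> J \<Longrightarrow> continuous_map Y euclidean (\<psi> j)"
    "\<And>x y. x \<in> topspace X \<Longrightarrow> y \<in> topspace Y \<Longrightarrow>
       norm (h (x, y) - (\<Sum>j\<in>J. h (x, j) * \<psi> j y)) \<le> e"
proof -
  have cr: "completely_regular_space Y"
    using Y by (simp add: normal_imp_completely_regular_space compact_Hausdorff_or_regular_imp_normal_space)
  \<comment> \<open>a bump at \<open>z\<close> that vanishes wherever \<open>h (x, y)\<close> is not close to \<open>h (x, z)\<close>\<close>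
  have "\<exists>\<phi>. continuous_map Y euclideanreal \<phi> \<and> (\<forall>y\<in>topspace Y. 0 \<le> \<phi> y) \<and> 0 < \<phi> z \<and>
          (\<forall>y\<in>topspace Y. \<phi> y \<noteq> 0 \<longrightarrow> (\<forall>x\<in>topspace X. norm (h (x, y) - h (x, z)) < e))"
    if z: "z \<in> topspace Y" for z
  proof -
    obtain U where U: "openin Y U" "z \<in> U" "\<And>y x. y \<in> U \<Longrightarrow> x \<in> topspace X \<Longrightarrow> norm (h (x, y) - h (x, z)) < e"
      using uniform_nbhd[OF X continuous_map_swap[OF h] z e] by auto
    obtain \<rho> :: "'c \<Rightarrow> real" where \<rho>: "continuous_map Y (top_of_set {0..1}) \<rho>" "\<rho> z = 0" "\<rho> ` (topspace Y - U) \<subseteq> {1}"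
      using cr U z unfolding completely_regular_space_def by (metis DiffD2 DiffI closedin_diff closedin_topspace)
    have "continuous_map Y euclideanreal (\<lambda>y. 1 - \<rho> y)" "\<forall>y\<in>topspace Y. 0 \<le> 1 - \<rho> y"
      using \<rho>(1) by (auto simp: continuous_map_in_subtopology image_subset_iff
          intro!: continuous_map_diff)
    moreover have "y \<in> U" if "y \<in> topspace Y" "1 - \<rho> y \<noteq> 0" for y
      using \<rho>(3) that by force
    then have "\<forall>y\<in>topspace Y. 1 - \<rho> y \<noteq> 0 \<longrightarrow> (\<forall>x\<in>topspace X. norm (h (x, y) - h (x, z)) < e)"
      using U(3) by blast
    moreover have "0 < 1 - \<rho> z" using \<rho>(2) by simp
    ultimately show ?thesis by (intro exI[of _ "\<lambda>y. 1 - \<rho> y"] conjI)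
  qed
  then obtain \<phi> where \<phi>: "\<And>z. z \<in> topspace Y \<Longrightarrow> continuous_map Y euclideanreal (\<phi> z)"
      "\<And>z y. z \<in> topspace Y \<Longrightarrow> y \<in> topspace Y \<Longrightarrow> 0 \<le> \<phi> z y" "\<And>z. z \<in> topspace Y \<Longrightarrow> 0 < \<phi> z z"
      "\<And>z y x. z \<in> topspace Y \<Longrightarrow> y \<in> topspace Y \<Longrightarrow> \<phi> z y \<noteq> 0 \<Longrightarrow> x \<in> topspace X \<Longrightarrow>
         norm (h (x, y) - h (x, z)) < e"
    by metis
  define V where "V z = {y \<in> topspace Y. \<phi> z y \<in> {0<..}}" for z
  have V: "openin Y (V z)" if "z \<in> topspace Y" for z
    unfolding V_def by (rule openin_continuous_map_preimage[OF \<phi>(1)[OF that]]) simp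
  have "\<exists>F. finite F \<and> F \<subseteq> V ` topspace Y \<and> topspace Y \<subseteq> \<Union>F"
  proof (rule compactinD)
    show "compactin Y (topspace Y)" using Y(1) by (simp add: compact_space_def)
    show "openin Y U" if "U \<in> V ` topspace Y" for U using that V by blast
    show "topspace Y \<subseteq> \<Union>(V ` topspace Y)"
    proof
      fix y assume "y \<in> topspace Y"
      then show "y \<in> \<Union>(V ` topspace Y)" using \<phi>(3)[of y] by (intro UN_I[of y]) (simp_all add: V_def)
    qed
  qed
  then obtain J where J: "finite J" "J \<subseteq> topspace Y" "topspace Y \<subseteq> \<Union>(V ` J)"
    by (metis finite_subset_image)
  define s where "s y = (\<Sum>j\<in>J. \<phi> j y)" for y
  have s_pos: "0 < s y" if y: "y \<in> topspace Y" for y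
  proof -
    obtain j where "j \<in> J" "0 < \<phi> j y" using J y by (auto simp: V_def)
    then show ?thesis
      unfolding s_def using J y \<phi>(2) by (intro sum_pos2[of J j]) auto
  qed
  have s_cont: "continuous_map Y euclideanreal s"
    unfolding s_def by (intro continuous_map_sum) (use J \<phi>(1) in auto)
  show ?thesis
  proof (rule that[of J "\<lambda>j y. complex_of_real (\<phi> j y / s y)"])
    fix j assume "j \<in> J"
    then have "continuous_map Y euclideanreal (\<phi> j)" using J \<phi>(1) by blast
    with s_cont show "continuous_map Y euclidean (\<lambda>y. complex_of_real (\<phi> j y / s y))"
      using s_pos unfolding continuous_map_atin limitin_canonical_iff
      by (auto intro!: tendsto_of_real tendsto_divide simp: less_imp_neq[symmetric])
  next
    fix x y assume x: "x \<in> topspace X" and y: "y \<in> topspace Y"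
    let ?\<psi> = "\<lambda>j. complex_of_real (\<phi> j y / s y)"
    have one: "(\<Sum>j\<in>J. \<phi> j y / s y) = 1"
      using s_pos[OF y] by (simp add: sum_divide_distrib[symmetric] s_def[symmetric])
    have "h (x, y) - (\<Sum>j\<in>J. h (x, j) * ?\<psi> j) = h (x, y) * (\<Sum>j\<in>J. ?\<psi> j) - (\<Sum>j\<in>J. h (x, j) * ?\<psi> j)"
      using one by (simp only: of_real_sum[symmetric]) simp
    also have "\<dots> = (\<Sum>j\<in>J. (h (x, y) - h (x, j)) * ?\<psi> j)"
      by (simp only: sum_distrib_left sum_subtractf left_diff_distrib)
    also have "norm \<dots> \<le> (\<Sum>j\<in>J. e * (\<phi> j y / s y))"
    proof (rule sum_norm_le)
      fix j assume j: "j \<in> J"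
      then have "0 \<le> \<phi> j y" using J y \<phi>(2) by blast
      moreover have "norm (h (x, y) - h (x, j)) * (\<phi> j y / s y) \<le> e * (\<phi> j y / s y)" if "\<phi> j y \<noteq> 0"
        using \<phi>(4)[of j y x] that j J x y s_pos[OF y] \<open>0 \<le> \<phi> j y\<close> by (intro mult_right_mono) auto
      ultimately show "norm ((h (x, y) - h (x, j)) * ?\<psi> j) \<le> e * (\<phi> j y / s y)"
        using s_pos[OF y] by (cases "\<phi> j y = 0") (auto simp: norm_mult norm_divide)
    qed
    also have "\<dots> = e" using one by (simp only: sum_distrib_left[symmetric] mult_1_right)
    finally show "norm (h (x, y) - (\<Sum>j\<in>J. h (x, j) * ?\<psi> j)) \<le> e" .
  qed (use J in auto)
qed

text \<open>
  For a function \<open>u x * v y\<close> both sides are \<open>L u * M v\<close>. By linearity and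
  \<open>separated_approximation\<close> they agree on a dense set, hence everywhere by boundedness.
\<close>

lemma bounded_functional_Fubini:
  fixes h :: "'b \<times> 'c \<Rightarrow> complex"
  assumes X: "compact_space X" and Y: "compact_space Y" "Hausdorff_space Y"
    and L: "bounded_functional X B L" and M: "bounded_functional Y C M"
    and h: "continuous_map (prod_topology X Y) euclidean h"
  shows "L (\<lambda>x. M (\<lambda>y. h (x, y))) = M (\<lambda>y. L (\<lambda>x. h (x, y)))"
proof -
  note B = bounded_functional_nonneg[OF L] bounded_functional_dist[OF L]
  note C = bounded_functional_nonneg[OF M] bounded_functional_dist[OF M]
  let ?a = "L (\<lambda>x. M (\<lambda>y. h (x, y)))" and ?b = "M (\<lambda>y. L (\<lambda>x. h (x, y)))"
  have close: "norm (?a - ?b) \<le> 2 * (B * C) * e" if e: "0 < e" for e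
  proof -
    obtain J and \<psi> :: "'c \<Rightarrow> 'c \<Rightarrow> complex" where J: "finite J" "J \<subseteq> topspace Y"
      and \<psi>: "\<And>j. j \<in> J \<Longrightarrow> continuous_map Y euclidean (\<psi> j)"
      and approx: "\<And>x y. x \<in> topspace X \<Longrightarrow> y \<in> topspace Y \<Longrightarrow>
         norm (h (x, y) - (\<Sum>j\<in>J. h (x, j) * \<psi> j y)) \<le> e"
      using separated_approximation[OF X Y h e] by metis
    have hj: "continuous_map X euclidean (\<lambda>x. h (x, j))" if "j \<in> J" for j
      using continuous_map_section_fst[OF h] J that by blast
    have comb: "continuous_map W euclidean (\<lambda>w. \<Sum>j\<in>J. \<phi> j w * c j)"
      if "\<And>j. j \<in> J \<Longrightarrow> continuous_map W euclidean (\<phi> j)" for W and \<phi> :: "'c \<Rightarrow> _ \<Rightarrow> complex" and c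
      by (intro continuous_map_sum J(1))
        (use that in \<open>simp add: continuous_map_atin tendsto_mult_right\<close>)
    let ?s = "\<Sum>j\<in>J. L (\<lambda>x. h (x, j)) * M (\<psi> j)"
    have "norm (M (\<lambda>y. h (x, y)) - (\<Sum>j\<in>J. h (x, j) * M (\<psi> j))) \<le> C * e"
      if x: "x \<in> topspace X" for x
    proof -
      have "norm (M (\<lambda>y. h (x, y)) - M (\<lambda>y. \<Sum>j\<in>J. \<psi> j y * h (x, j))) \<le> C * e"
        using e approx[OF x]
        by (intro C(2) continuous_map_section[OF h x] comb \<psi>) (auto simp: mult.commute)
      then show ?thesis
        using bounded_functional_sum[OF M J(1) \<psi>, where c = "\<lambda>j. h (x, j)"] by (simp add: mult.commute)
    qed
    then have "norm (?a - L (\<lambda>x. \<Sum>j\<in>J. h (x, j) * M (\<psi> j))) \<le> B * (C * e)"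
      using e C(1)
      by (intro B(2) continuous_map_bounded_functional[OF Y(1) M h] comb hj) auto
    then have 1: "norm (?a - ?s) \<le> B * (C * e)"
      using bounded_functional_sum[OF L J(1) hj] by simp
    have "norm (L (\<lambda>x. h (x, y)) - (\<Sum>j\<in>J. L (\<lambda>x. h (x, j)) * \<psi> j y)) \<le> B * e"
      if y: "y \<in> topspace Y" for y
    proof -
      have "norm (L (\<lambda>x. h (x, y)) - L (\<lambda>x. \<Sum>j\<in>J. h (x, j) * \<psi> j y)) \<le> B * e"
        using e approx[OF _ y] by (intro B(2) continuous_map_section_fst[OF h y] comb hj) auto
      then show ?thesis using bounded_functional_sum[OF L J(1) hj] by simp
    qed
    then have "norm (?b - M (\<lambda>y. \<Sum>j\<in>J. \<psi> j y * L (\<lambda>x. h (x, j)))) \<le> C * (B * e)"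
      using e B(1) continuous_map_bounded_functional[OF X L continuous_map_swap[OF h]]
      by (intro C(2) comb \<psi>) (auto simp: mult.commute)
    then have "norm (?b - ?s) \<le> C * (B * e)"
      using bounded_functional_sum[OF M J(1) \<psi>, where c = "\<lambda>j. L (\<lambda>x. h (x, j))"]
      by (simp add: mult.commute)
    moreover have "norm (?a - ?b) \<le> norm (?a - ?s) + norm (?b - ?s)"
      using norm_triangle_ineq4[of "?a - ?s" "?b - ?s"] by simp
    ultimately show ?thesis using 1 by (simp add: algebra_simps)
  qed
  have "norm (?a - ?b) \<le> 0"
  proof (rule field_le_epsilon)
    fix e :: real assume e: "0 < e"
    define d where "d = e / (2 * (B * C) + 1)"
    have p: "0 < 2 * (B * C) + 1" using B(1) C(1) by (simp add: add_nonneg_pos)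
    then have d: "0 < d" using e by (simp add: d_def)
    have "(2 * (B * C) + 1) * d = e" using p by (simp add: d_def)
    with d have "2 * (B * C) * d \<le> e" by (simp add: algebra_simps)
    with d show "norm (?a - ?b) \<le> 0 + e" using close by fastforce
  qed
  then show ?thesis by simp
qed

section \<open>Averages over invariant functionals\<close>

text \<open>
  \<open>A\<close> stands for integration over \<open>K\<close> and \<open>I\<close> for integration over \<open>G\<close> against \<open>\<mu>\<close>,
  whose support is contained in the compact set \<open>S\<close>. Besides boundedness only their invariance is
  recorded: \<open>A\<close> under left translation, \<open>I\<close> under the action. The type \<open>'k\<close> with an explicit
  action records that nothing but the action of \<open>K\<close> on \<open>G\<close> enters.
\<close>

locale invariant_average =
  fixes T :: "'k topology" and S :: "'a::{topological_group_add, t2_space} set"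
    and mul :: "'k \<Rightarrow> 'k \<Rightarrow> 'k" and act :: "'k \<Rightarrow> 'a \<Rightarrow> 'a"
    and A :: "('k \<Rightarrow> complex) \<Rightarrow> complex" and I :: "('a \<Rightarrow> complex) \<Rightarrow> complex" and B C :: real
  assumes T: "compact_space T" "Hausdorff_space T" and S: "compact S"
    and A: "bounded_functional T B A" and I: "bounded_functional (top_of_set S) C I"
    and act: "continuous_map (prod_topology T euclidean) euclidean (\<lambda>(k, x). act k x)"
    and auto_or_anti: "k \<in> topspace T \<Longrightarrow>
      (\<forall>x y. act k (x + y) = act k x + act k y) \<or> (\<forall>x y. act k (x + y) = act k y + act k x)"
    and act_mul: "k \<in> topspace T \<Longrightarrow> l \<in> topspace T \<Longrightarrow> act (mul k l) x = act k (act l x)"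
    and mul: "k \<in> topspace T \<Longrightarrow> continuous_map T T (mul k)"
    and A_invariant: "k \<in> topspace T \<Longrightarrow> continuous_map T euclidean \<phi> \<Longrightarrow> A (\<lambda>l. \<phi> (mul k l)) = A \<phi>"
    and I_invariant: "k \<in> topspace T \<Longrightarrow> continuous_on UNIV \<psi> \<Longrightarrow> I (\<lambda>t. \<psi> (act k t)) = I \<psi>"
begin

abbreviation "TS \<equiv> prod_topology T (top_of_set S)"

text \<open>
  Taking both integrals together lets two double integrals be exchanged in one step.
\<close>

definition "P \<phi> = A (\<lambda>k. I (\<lambda>t. \<phi> (k, t)))"

text \<open>
  This is the left-hand integral of the theorem, with \<open>p = (k, t)\<close>.
\<close>

definition "average f x y = P (\<lambda>p. f (x + snd p + act (fst p) y))"

lemma compact_S: "compact_space (top_of_set S)"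
  using S by (simp add: compact_space_subtopology)

lemma Hausdorff_S: "Hausdorff_space (top_of_set S)"
proof (rule Hausdorff_space_subtopology)
  show "Hausdorff_space (euclidean :: 'a topology)"
    unfolding Hausdorff_space_def disjnt_def using hausdorff by fastforce
qed

lemma compact_TS: "compact_space TS" "Hausdorff_space TS"
  using T compact_S Hausdorff_S
  by (simp_all add: compact_space_prod_topology Hausdorff_space_prod_topology)

lemma P: "bounded_functional TS (B * C) P"
  unfolding P_def[abs_def] by (rule bounded_functional_prod[OF T(1) compact_S A I])

lemma continuous_proj:
  "continuous_map Z (prod_topology X Y) u \<Longrightarrow> continuous_map Z X (\<lambda>z. fst (u z))"
  "continuous_map Z (prod_topology X Y) u \<Longrightarrow> continuous_map Z Y (\<lambda>z. snd (u z))"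
  using continuous_map_fst_of[of Z X Y u] continuous_map_snd_of[of Z X Y u] by (simp_all add: o_def)

lemma continuous_add:
  fixes u v :: "_ \<Rightarrow> 'a"
  assumes "continuous_map Z euclidean u" "continuous_map Z euclidean v"
  shows "continuous_map Z euclidean (\<lambda>z. u z + v z)"
  using assms by (simp add: continuous_map_atin tendsto_add)

lemma continuous_act:
  assumes "continuous_map Z T u" "continuous_map Z euclidean v"
  shows "continuous_map Z euclidean (\<lambda>z. act (u z) (v z))"
  using continuous_map_compose[OF continuous_map_pairedI[OF assms] act] by (simp add: o_def)

lemma continuous_const: "continuous_map Z euclidean (\<lambda>z. c)"
  by simp

lemma continuous_comp:
  assumes "continuous_on UNIV f" "continuous_map Z euclidean u"
  shows "continuous_map Z euclidean (\<lambda>z. f (u z))"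
  using continuous_map_compose[OF assms(2), of euclidean f] assms(1) by (simp add: o_def)

lemmas continuous = continuous_add continuous_act continuous_const

lemma continuous_P:
  fixes h :: "'z \<times> 'k \<times> 'a \<Rightarrow> complex"
  assumes "continuous_map (prod_topology Z TS) euclidean h"
  shows "continuous_map Z euclidean (\<lambda>z. P (\<lambda>p. h (z, p)))"
  by (rule continuous_map_bounded_functional[OF compact_TS(1) P assms])

lemma TS_proj:
  shows k_cont: "continuous_map TS T fst" and t_cont: "continuous_map TS euclidean snd"
  using continuous_map_into_fulltopology[OF continuous_map_snd, of T euclidean S]
  by (simp_all add: continuous_map_fst)

lemma continuous_average:
  assumes f: "continuous_on UNIV f"
    and u: "continuous_map Z euclidean u" and v: "continuous_map Z euclidean v"
  shows "continuous_map Z euclidean (\<lambda>z. average f (u z) (v z))"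
proof -
  let ?Z = "prod_topology Z TS"
  have u': "continuous_map ?Z euclidean (\<lambda>z. u (fst z))"
    using continuous_map_compose[OF continuous_map_fst u] by (simp add: o_def)
  have v': "continuous_map ?Z euclidean (\<lambda>z. v (fst z))"
    using continuous_map_compose[OF continuous_map_fst v] by (simp add: o_def)
  have k: "continuous_map ?Z T (\<lambda>z. fst (snd z))"
    using continuous_map_compose[OF continuous_map_snd k_cont] by (simp add: o_def)
  have t: "continuous_map ?Z euclidean (\<lambda>z. snd (snd z))"
    using continuous_map_compose[OF continuous_map_snd t_cont] by (simp add: o_def)
  have "continuous_map ?Z euclidean
          (\<lambda>z. f (u (fst z) + snd (snd z) + act (fst (snd z)) (v (fst z))))"
    by (intro continuous_comp[OF f] continuous u' v' k t)
  from continuous_P[OF this] show ?thesis by (simp add: average_def)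
qed

text \<open>
  Invariance of both functionals: \<open>act k\<close> is removed from \<open>t\<close> first, for each fixed \<open>l\<close>, and
  then \<open>mul k l\<close> is replaced by \<open>l\<close>.
\<close>

lemma P_shift:
  fixes \<phi> :: "'k \<Rightarrow> 'a \<Rightarrow> complex"
  assumes k: "k \<in> topspace T"
    and \<phi>: "continuous_map (prod_topology T euclidean) euclidean (\<lambda>(l, t). \<phi> l t)"
  shows "P (\<lambda>p. \<phi> (mul k (fst p)) (act k (snd p))) = P (\<lambda>p. \<phi> (fst p) (snd p))"
proof -
  have mk: "mul k l \<in> topspace T" if "l \<in> topspace T" for l
    using continuous_map_image_subset_topspace[OF mul[OF k]] that by blast
  have \<phi>l: "continuous_on UNIV (\<phi> l)" if "l \<in> topspace T" for l
    using continuous_map_section[OF \<phi> that] by simp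
  have S: "continuous_map (prod_topology T (top_of_set S)) euclidean (\<lambda>(l, t). \<phi> l t)"
    using continuous_map_compose[OF continuous_map_pairedI[OF TS_proj] \<phi>]
    by (simp add: o_def case_prod_unfold)
  have c: "continuous_map T euclidean (\<lambda>l. I (\<phi> l))"
    using continuous_map_bounded_functional[OF compact_S I S] by simp
  have c': "continuous_map T euclidean (\<lambda>l. I (\<phi> (mul k l)))"
    using continuous_map_compose[OF mul[OF k] c] by (simp add: o_def)
  have act_k: "continuous_map Z euclidean (\<lambda>z. act k (u z))" if "continuous_map Z euclidean u"
    for Z :: "'z topology" and u
    using that k by (intro continuous_act) auto
  have "continuous_map TS euclidean (\<lambda>p. (\<lambda>(l, t). \<phi> l t) (mul k (fst p), act k (snd p)))"
    using continuous_map_compose[OF continuous_map_pairedI[OF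
        continuous_map_compose[OF k_cont mul[OF k]] act_k[OF t_cont]] \<phi>]
    by (simp add: o_def)
  from continuous_map_bounded_functional[OF compact_S I this]
  have c'': "continuous_map T euclidean (\<lambda>l. I (\<lambda>t. \<phi> (mul k l) (act k t)))"
    by simp
  have "A (\<lambda>l. I (\<lambda>t. \<phi> (mul k l) (act k t))) = A (\<lambda>l. I (\<phi> (mul k l)))"
    by (rule bounded_functional_cong[OF A c'' c']) (rule I_invariant[OF k \<phi>l[OF mk]])
  also have "\<dots> = A (\<lambda>l. I (\<phi> l))"
    by (rule A_invariant[OF k c])
  finally show ?thesis by (simp add: P_def)
qed

lemma P_add:
  assumes "continuous_map TS euclidean \<phi>" "continuous_map TS euclidean \<psi>"
  shows "P (\<lambda>p. \<phi> p + \<psi> p) = P \<phi> + P \<psi>"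
  by (rule bounded_functional_add[OF P assms])

text \<open>
  An automorphism \<open>k\<close> turns \<open>x + t + l y\<close> into \<open>k x + k t + k (l y)\<close>, and an antiautomorphism
  turns it into the same sum in reverse order. So each of the two terms on the left may become
  either term on the right, but their sum does not depend on which kind \<open>k\<close> is. This is
  why equation (E) has two terms. Invariance then absorbs \<open>k\<close> from \<open>k t\<close> and from \<open>k (l y)\<close>.
\<close>

lemma P_symmetrised:
  fixes f :: "'a \<Rightarrow> complex"
  assumes f: "continuous_on UNIV f" and k: "k \<in> topspace T"
  shows "P (\<lambda>p. f (z + act k (x + snd p + act (fst p) y)))
       + P (\<lambda>p. f (z + act k (act (fst p) y + snd p + x)))
     = average f (z + act k x) y + P (\<lambda>p. f (z + act (fst p) y + snd p + act k x))"
proof -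
  note fc = continuous_comp[OF f]
  have act_k: "continuous_map Z euclidean (\<lambda>z. act k (u z))" if "continuous_map Z euclidean u"
    for Z :: "'z topology" and u
    using that k by (intro continuous_act) auto
  have pr: "continuous_map (prod_topology T euclidean) T (\<lambda>p. fst p)"
    "continuous_map (prod_topology T euclidean) euclidean (\<lambda>p. snd p)"
    by (simp_all add: continuous_map_fst continuous_map_snd)
  let ?\<phi> = "\<lambda>l t. f (z + act k x + t + act l y) + f (z + act l y + t + act k x)"
  have \<phi>: "continuous_map (prod_topology T euclidean) euclidean (\<lambda>(l, t). ?\<phi> l t)"
    unfolding case_prod_unfold by (intro continuous_map_add fc continuous pr)
  have c: "continuous_map TS euclidean (\<lambda>p. f (z + act k (x + snd p + act (fst p) y)))"
    "continuous_map TS euclidean (\<lambda>p. f (z + act k (act (fst p) y + snd p + x)))"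
    "continuous_map TS euclidean (\<lambda>p. f (z + act k x + snd p + act (fst p) y))"
    "continuous_map TS euclidean (\<lambda>p. f (z + act (fst p) y + snd p + act k x))"
    by (intro fc act_k continuous TS_proj)+
  have mk: "continuous_map TS T (\<lambda>p. mul k (fst p))"
    using continuous_map_compose[OF k_cont mul[OF k]] by (simp add: o_def)
  have c': "continuous_map TS euclidean (\<lambda>p. ?\<phi> (mul k (fst p)) (act k (snd p)))"
    by (intro continuous_map_add fc act_k continuous TS_proj mk)
  have "P (\<lambda>p. f (z + act k (x + snd p + act (fst p) y)))
       + P (\<lambda>p. f (z + act k (act (fst p) y + snd p + x)))
     = P (\<lambda>p. f (z + act k (x + snd p + act (fst p) y)) + f (z + act k (act (fst p) y + snd p + x)))"
    by (rule P_add[OF c(1,2), symmetric])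
  also have "\<dots> = P (\<lambda>p. ?\<phi> (mul k (fst p)) (act k (snd p)))"
  proof (rule bounded_functional_cong[OF P continuous_map_add[OF c(1,2)] c'])
    fix p assume "p \<in> topspace TS"
    then have m: "act (mul k (fst p)) y = act k (act (fst p) y)"
      using k by (intro act_mul) auto
    show "f (z + act k (x + snd p + act (fst p) y)) + f (z + act k (act (fst p) y + snd p + x))
        = ?\<phi> (mul k (fst p)) (act k (snd p))"
      using auto_or_anti[OF k]
    proof
      assume "\<forall>x y. act k (x + y) = act k x + act k y"
      then show ?thesis by (simp add: m add.assoc)
    next
      assume "\<forall>x y. act k (x + y) = act k y + act k x"
      then show ?thesis by (simp add: m add.assoc add.commute[of "f _" "f _"])
    qed
  qed
  also have "\<dots> = P (\<lambda>p. ?\<phi> (fst p) (snd p))"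
    by (rule P_shift[OF k \<phi>])
  also have "\<dots> = average f (z + act k x) y + P (\<lambda>p. f (z + act (fst p) y + snd p + act k x))"
    unfolding average_def by (rule P_add[OF c(3,4)])
  finally show ?thesis .
qed

text \<open>
  With \<open>q = (l, s)\<close> and \<open>p = (k, t)\<close> the integrand is \<open>f (w + s + k y + t + l x)\<close>. It becomes an
  average of \<open>f\<close> by integrating over \<open>l\<close> and \<open>t\<close> first. As \<open>l\<close> and \<open>t\<close> belong to different
  pairs, an exchange of \<open>p\<close> and \<open>q\<close> does not help; instead \<open>l\<close> is moved past the pair \<open>(s, k)\<close>, and
  then \<open>s\<close> past \<open>k\<close>.
\<close>

lemma P_average_swap:
  assumes f: "continuous_on UNIV f"
  shows "P (\<lambda>q. P (\<lambda>p. f (w + snd q + act (fst p) y + snd p + act (fst q) x)))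
       = P (\<lambda>q. average f (w + snd q + act (fst q) y) x)"
proof -
  let ?S = "top_of_set S"
  let ?ST = "prod_topology ?S T"
  have ST: "compact_space ?ST" "Hausdorff_space ?ST"
    using T compact_S Hausdorff_S
    by (simp_all add: compact_space_prod_topology Hausdorff_space_prod_topology)
  define Q where "Q \<phi> = I (\<lambda>s. A (\<lambda>k. \<phi> (s, k)))" for \<phi>
  have Q: "bounded_functional ?ST (C * B) Q"
    unfolding Q_def[abs_def] by (rule bounded_functional_prod[OF compact_S T(1) I A])
  let ?h = "\<lambda>(l, (s, k)). I (\<lambda>t. f (w + s + act k y + t + act l x))"
  have h: "continuous_map (prod_topology T ?ST) euclidean ?h"
  proof -
    let ?Z = "prod_topology (prod_topology T ?ST) ?S"
    have fst: "continuous_map ?Z (prod_topology T ?ST) (\<lambda>z. fst z)"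
      by (rule continuous_map_fst)
    note s = continuous_proj(2)[OF fst]
    have "continuous_map ?Z euclidean (\<lambda>z. fst (snd (fst z)))"
      by (rule continuous_map_into_fulltopology[OF continuous_proj(1)[OF s]])
    moreover have "continuous_map ?Z euclidean (\<lambda>z. snd z)"
      by (rule continuous_map_into_fulltopology[OF continuous_map_snd])
    moreover note continuous_proj(1)[OF fst] continuous_proj(2)[OF s]
    ultimately have "continuous_map ?Z euclidean
        (\<lambda>z. f (w + fst (snd (fst z)) + act (snd (snd (fst z))) y + snd z + act (fst (fst z)) x))"
      by (intro continuous_comp[OF f] continuous)
    from continuous_map_bounded_functional[OF compact_S I this] show ?thesis
      by (simp add: case_prod_unfold)
  qed
  have "P (\<lambda>q. P (\<lambda>p. f (w + snd q + act (fst p) y + snd p + act (fst q) x)))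
      = A (\<lambda>l. Q (\<lambda>p. ?h (l, p)))"
    by (simp add: P_def Q_def)
  also have "\<dots> = Q (\<lambda>p. A (\<lambda>l. ?h (l, p)))"
    by (rule bounded_functional_Fubini[OF T(1) ST A Q h])
  also have "\<dots> = I (\<lambda>s. A (\<lambda>k. average f (w + s + act k y) x))"
    by (simp add: Q_def average_def P_def)
  also have "\<dots> = A (\<lambda>k. I (\<lambda>s. average f (w + s + act k y) x))"
  proof -
    have "continuous_map ?ST T (\<lambda>z. snd z)" by (rule continuous_map_snd)
    moreover have "continuous_map ?ST euclidean (\<lambda>z. fst z)"
      by (rule continuous_map_into_fulltopology[OF continuous_map_fst])
    ultimately have "continuous_map ?ST euclidean (\<lambda>z. average f (w + fst z + act (snd z) y) x)"
      by (intro continuous_average[OF f] continuous)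
    from bounded_functional_Fubini[OF compact_S T I A this] show ?thesis by simp
  qed
  also have "\<dots> = P (\<lambda>q. average f (w + snd q + act (fst q) y) x)"
    by (simp add: P_def)
  finally show ?thesis .
qed

text \<open>
  The identity that carries the theorem. It is exact for every continuous \<open>f\<close>. On the left the
  outer variables sit in the second argument of the average, where the approximate equation
  \<open>average f x y \<approx> f x * g y\<close> brings in \<open>g\<close> at the points occurring in (E); on the right they
  sit in the first argument, where applying the approximate equation twice gives
  \<open>f w * g x * g y\<close>.
\<close>

lemma average_symmetrised:
  assumes f: "continuous_on UNIV f"
  shows "P (\<lambda>p. average f w (x + snd p + act (fst p) y)) + P (\<lambda>p. average f w (act (fst p) y + snd p + x))
       = P (\<lambda>q. average f (w + snd q + act (fst q) x) y) + P (\<lambda>q. average f (w + snd q + act (fst q) y) x)"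
proof -
  let ?Z = "prod_topology TS TS"
  have pr: "continuous_map ?Z T (\<lambda>z. fst (fst z))" "continuous_map ?Z T (\<lambda>z. fst (snd z))"
    "continuous_map ?Z euclidean (\<lambda>z. snd (fst z))" "continuous_map ?Z euclidean (\<lambda>z. snd (snd z))"
    using continuous_map_compose[OF continuous_map_fst[of TS TS] k_cont]
      continuous_map_compose[OF continuous_map_snd[of TS TS] k_cont]
      continuous_map_compose[OF continuous_map_fst[of TS TS] t_cont]
      continuous_map_compose[OF continuous_map_snd[of TS TS] t_cont]
    by (simp_all add: o_def)
  note fc = continuous_comp[OF f]
  \<comment> \<open>\<open>p\<close> is the pair of the outer average on the left, \<open>q\<close> the pair inside \<open>average f\<close>\<close>
  let ?\<Phi> = "\<lambda>q p. f (w + snd q + act (fst q) (x + snd p + act (fst p) y))"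
  let ?\<Psi> = "\<lambda>q p. f (w + snd q + act (fst q) (act (fst p) y + snd p + x))"
  let ?X = "\<lambda>q p. f (w + snd q + act (fst p) y + snd p + act (fst q) x)"
  have \<Phi>: "continuous_map ?Z euclidean (\<lambda>z. ?\<Phi> (fst z) (snd z))"
    and \<Psi>: "continuous_map ?Z euclidean (\<lambda>z. ?\<Psi> (fst z) (snd z))"
    and X: "continuous_map ?Z euclidean (\<lambda>z. ?X (fst z) (snd z))"
    by (intro fc continuous pr)+
  note Fubini = bounded_functional_Fubini[OF compact_TS(1) compact_TS P P]
  have 1: "P (\<lambda>p. average f w (x + snd p + act (fst p) y)) = P (\<lambda>q. P (?\<Phi> q))"
    using Fubini[OF \<Phi>] by (simp add: average_def)
  have 2: "P (\<lambda>p. average f w (act (fst p) y + snd p + x)) = P (\<lambda>q. P (?\<Psi> q))"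
    using Fubini[OF \<Psi>] by (simp add: average_def)
  have c: "continuous_map TS euclidean (\<lambda>q. P (?\<Phi> q))" "continuous_map TS euclidean (\<lambda>q. P (?\<Psi> q))"
    "continuous_map TS euclidean (\<lambda>q. P (?X q))"
    using continuous_P[OF \<Phi>] continuous_P[OF \<Psi>] continuous_P[OF X] by simp_all
  have a: "continuous_map TS euclidean (\<lambda>q. average f (w + snd q + act (fst q) x) y)"
    by (intro continuous_average[OF f] continuous TS_proj)
  have "P (\<lambda>q. P (?\<Phi> q)) + P (\<lambda>q. P (?\<Psi> q)) = P (\<lambda>q. P (?\<Phi> q) + P (?\<Psi> q))"
    by (rule P_add[OF c(1,2), symmetric])
  also have "\<dots> = P (\<lambda>q. average f (w + snd q + act (fst q) x) y + P (?X q))"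
    by (rule bounded_functional_cong[OF P])
      (auto intro!: continuous_map_add c a P_symmetrised[OF f])
  also have "\<dots> = P (\<lambda>q. average f (w + snd q + act (fst q) x) y) + P (\<lambda>q. P (?X q))"
    by (rule P_add[OF a c(3)])
  finally show ?thesis unfolding 1 2 P_average_swap[OF f] .
qed

text \<open>
  Let \<open>E\<close> be the defect of (E) at \<open>x, y\<close>. Replacing each average in \<open>average_symmetrised\<close> by the
  product near it gives \<open>f w * E\<close> up to an error that does not depend on \<open>w\<close>. As \<open>f\<close> is
  unbounded, \<open>E\<close> must vanish.
\<close>

lemma equation_of_unbounded:
  assumes f: "continuous_on UNIV f" and g: "continuous_on UNIV g"
    and \<delta>: "0 \<le> \<delta>" and approx: "\<And>x y. norm (average f x y - f x * g y) \<le> \<delta>"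
    and unbounded: "\<not> bounded (range f)"
  shows "average g x y + P (\<lambda>p. g (act (fst p) y + snd p + x)) = 2 * g x * g y"
proof -
  define E where "E = average g x y + P (\<lambda>p. g (act (fst p) y + snd p + x)) - 2 * g x * g y"
  let ?D = "B * C * \<delta>"
  \<comment> \<open>the approximate equation at \<open>(w, u p)\<close>, integrated over \<open>p\<close>\<close>
  have left: "norm (P (\<lambda>p. average f w (u p)) - f w * P (\<lambda>p. g (u p))) \<le> ?D"
    if u: "continuous_map TS euclidean u" for u w
  proof -
    have gu: "continuous_map TS euclidean (\<lambda>p. g (u p))" by (rule continuous_comp[OF g u])
    have m: "continuous_map TS euclidean (\<lambda>p. f w * g (u p))"
      using gu by (simp add: continuous_map_atin tendsto_mult_left)
    have "norm (P (\<lambda>p. average f w (u p)) - P (\<lambda>p. f w * g (u p))) \<le> ?D"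
      by (rule bounded_functional_dist[OF P _ m \<delta> approx])
        (rule continuous_average[OF f continuous_const u])
    then show ?thesis by (simp add: bounded_functional_mult_left[OF P gu])
  qed
  \<comment> \<open>the approximate equation at second argument \<open>b\<close>, integrated, and then at \<open>(w, a)\<close>\<close>
  have right: "norm (P (\<lambda>q. average f (w + snd q + act (fst q) a) b) - f w * g a * g b) \<le> ?D + \<delta> * norm (g b)"
    for w a b
  proof -
    let ?u = "\<lambda>q. w + snd q + act (fst q) a"
    have u: "continuous_map TS euclidean ?u" by (intro continuous TS_proj)
    have fu: "continuous_map TS euclidean (\<lambda>q. f (?u q))" by (rule continuous_comp[OF f u])
    have m: "continuous_map TS euclidean (\<lambda>q. f (?u q) * g b)"
      using fu by (simp add: continuous_map_atin tendsto_mult_right)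
    have "norm (P (\<lambda>q. average f (?u q) b) - P (\<lambda>q. f (?u q) * g b)) \<le> ?D"
      by (rule bounded_functional_dist[OF P _ m \<delta> approx])
        (rule continuous_average[OF f u continuous_const])
    then have 1: "norm (P (\<lambda>q. average f (?u q) b) - average f w a * g b) \<le> ?D"
      by (simp add: bounded_functional_mult_right[OF P fu] average_def)
    have "norm (average f w a * g b - f w * g a * g b) \<le> \<delta> * norm (g b)"
      unfolding left_diff_distrib[symmetric] norm_mult by (intro mult_right_mono approx) simp
    with 1 show ?thesis by (rule norm_diff_triangle_le)
  qed
  let ?c = "4 * ?D + \<delta> * norm (g x) + \<delta> * norm (g y)"
  have bound: "norm (f w) * norm E \<le> ?c" for w
  proof -
    let ?l1 = "P (\<lambda>p. average f w (x + snd p + act (fst p) y))" and ?m1 = "average g x y"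
    let ?l2 = "P (\<lambda>p. average f w (act (fst p) y + snd p + x))"
    let ?m2 = "P (\<lambda>p. g (act (fst p) y + snd p + x))"
    let ?r1 = "P (\<lambda>q. average f (w + snd q + act (fst q) x) y)"
    let ?r2 = "P (\<lambda>q. average f (w + snd q + act (fst q) y) x)"
    have l1: "norm (?l1 - f w * ?m1) \<le> ?D"
      unfolding average_def[of g] by (intro left continuous TS_proj)
    have l2: "norm (?l2 - f w * ?m2) \<le> ?D"
      by (intro left continuous TS_proj)
    have "f w * E = (?r1 - f w * g x * g y) + (?r2 - f w * g y * g x)
        - (?l1 - f w * ?m1) - (?l2 - f w * ?m2)"
      using average_symmetrised[OF f, of w x y] unfolding E_def by (simp add: algebra_simps)
    also have "norm \<dots> \<le> (?D + \<delta> * norm (g y)) + (?D + \<delta> * norm (g x)) + ?D + ?D"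
      by (rule norm_triangle_le_diff[OF add_mono[OF norm_triangle_le_diff[OF add_mono[OF
            norm_triangle_mono[OF right right] l1]] l2]])
    finally show ?thesis
      by (simp add: norm_mult)
  qed
  have "E = 0"
  proof (rule ccontr)
    assume "E \<noteq> 0"
    then have "norm (f w) \<le> ?c / norm E" for w
      using bound[of w] by (simp add: pos_le_divide_eq)
    then have "bounded (range f)" by (intro boundedI[of _ "?c / norm E"]) auto
    with unbounded show False by simp
  qed
  then show ?thesis by (simp add: E_def)
qed

text \<open>
  The average of a bounded function is bounded, so \<open>f x * g y\<close> is bounded in \<open>y\<close>.
\<close>

lemma bounded_factor:
  assumes f: "continuous_on UNIV f" and bf: "bounded (range f)" and nz: "f x \<noteq> 0"
    and approx: "\<And>x y. norm (average f x y - f x * g y) \<le> \<delta>"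
  shows "bounded (range g)"
proof -
  obtain b where b: "norm (f z) \<le> b" for z
    using bf by (auto simp: bounded_iff)
  have b0: "0 \<le> b" using b[of 0] norm_ge_zero order_trans by blast
  have "norm (g y) \<le> (B * C * b + \<delta>) / norm (f x)" for y
  proof -
    have "norm (average f x y) \<le> B * C * b"
      unfolding average_def
      by (rule bounded_functional_bound[OF P _ b0 b]) (intro continuous_comp[OF f] continuous TS_proj)
    then have "norm (f x * g y) \<le> B * C * b + \<delta>"
      using approx[of x y] norm_triangle_ineq3[of "average f x y" "f x * g y"] by linarith
    then show ?thesis using nz by (simp add: norm_mult field_simps)
  qed
  then show ?thesis by (intro boundedI[of _ "(B * C * b + \<delta>) / norm (f x)"]) auto
qed

end

section \<open>Haar measure and complex measures as bounded functionals\<close>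

text \<open>
  The set integral lets one statement cover both a measure on the compact space \<open>X\<close> itself and a
  measure on a larger space restricted to \<open>X\<close>.
\<close>

lemma bounded_functional_set_integral:
  assumes X: "compact_space X" and M: "finite_measure M" and sets: "topspace X \<in> sets M"
    and meas: "\<And>\<phi> :: 'b \<Rightarrow> complex. continuous_map X euclidean \<phi> \<Longrightarrow> set_borel_measurable M (topspace X) \<phi>"
  shows "bounded_functional X (measure M (space M)) (\<lambda>\<phi>. LINT x:topspace X|M. \<phi> x)"
proof -
  have int: "set_integrable M (topspace X) \<phi>" if \<phi>: "continuous_map X euclidean \<phi>" for \<phi> :: "'b \<Rightarrow> complex"
  proof -
    have "compact (\<phi> ` topspace X)"
      using image_compactin[of X "topspace X" euclidean \<phi>] X \<phi> by (simp add: compact_space_def)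
    then obtain b where b: "\<And>x. x \<in> topspace X \<Longrightarrow> norm (\<phi> x) \<le> b"
      by (meson bounded_iff compact_imp_bounded imageI)
    show ?thesis
      unfolding set_integrable_def
      by (rule finite_measure.integrable_const_bound[OF M, of _ "max b 0"])
        (use meas[OF \<phi>] b in \<open>auto simp: set_borel_measurable_def indicator_def le_max_iff_disj\<close>)
  qed
  have bound: "norm (LINT x:topspace X|M. \<phi> x) \<le> measure M (space M) * b"
    if \<phi>: "continuous_map X euclidean \<phi>" and b: "0 \<le> b" "\<forall>x\<in>topspace X. norm (\<phi> x) \<le> b"
    for \<phi> :: "'b \<Rightarrow> complex" and b
  proof -
    have "norm (LINT x:topspace X|M. \<phi> x) \<le> (LINT x|M. norm (indicator (topspace X) x *\<^sub>R \<phi> x))"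
      unfolding set_lebesgue_integral_def by (rule integral_norm_bound)
    also have "\<dots> \<le> (LINT x|M. b)"
      using int[OF \<phi>] b
      by (intro integral_mono integrable_norm finite_measure.integrable_const[OF M])
        (auto simp: set_integrable_def indicator_def)
    finally show ?thesis by simp
  qed
  show ?thesis
    unfolding bounded_functional_def
    using int bound by (simp add: set_integral_add)
qed

lemma bounded_functional_linear_combination:
  assumes L: "bounded_functional X B L" and M: "bounded_functional X C M"
  shows "bounded_functional X (B + norm c * C) (\<lambda>\<phi>. L \<phi> + c * M \<phi>)"
  unfolding bounded_functional_def
proof (intro conjI allI impI)
  show "0 \<le> B + norm c * C"
    using bounded_functional_nonneg[OF L] bounded_functional_nonneg[OF M] by simp
  fix \<phi> :: "_ \<Rightarrow> complex" assume \<phi>: "continuous_map X euclidean \<phi>"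
  show "L (\<lambda>x. \<phi> x + \<psi> x) + c * M (\<lambda>x. \<phi> x + \<psi> x) = L \<phi> + c * M \<phi> + (L \<psi> + c * M \<psi>)"
    if "continuous_map X euclidean \<psi>" for \<psi>
    using that by (simp add: bounded_functional_add[OF L \<phi>] bounded_functional_add[OF M \<phi>] algebra_simps)
  show "L (\<lambda>x. d * \<phi> x) + c * M (\<lambda>x. d * \<phi> x) = d * (L \<phi> + c * M \<phi>)" for d
    by (simp add: bounded_functional_mult_left[OF L \<phi>] bounded_functional_mult_left[OF M \<phi>] algebra_simps)
  fix b :: real assume b: "0 \<le> b" "\<forall>x\<in>topspace X. norm (\<phi> x) \<le> b"
  have "norm (L \<phi>) \<le> B * b" "norm (M \<phi>) \<le> C * b"
    using b by (auto intro: bounded_functional_bound[OF L \<phi>] bounded_functional_bound[OF M \<phi>])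
  then have "norm (L \<phi> + c * M \<phi>) \<le> B * b + norm c * (C * b)"
    by (intro norm_triangle_mono) (auto simp: norm_mult intro: mult_left_mono)
  then show "norm (L \<phi> + c * M \<phi>) \<le> (B + norm c * C) * b"
    by (simp add: algebra_simps)
qed

text \<open>
  Haar invariance is given for images of sets. The preimage of a set under translation by \<open>g\<close> is its
  image under translation by the inverse of \<open>g\<close>, so the image measure is \<open>\<kappa>\<close> again.
\<close>

lemma normalized_haar_measure_shift:
  fixes \<phi> :: "'b \<Rightarrow> complex"
  assumes G: "compact_group G T" and \<kappa>: "normalized_haar_measure G T \<kappa>"
    and g: "g \<in> carrier G" and \<phi>: "\<phi> \<in> borel_measurable \<kappa>"
  shows "(LINT x|\<kappa>. \<phi> (g \<otimes>\<^bsub>G\<^esub> x)) = (LINT x|\<kappa>. \<phi> x)"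
proof -
  interpret group G using G by (simp add: compact_group_def)
  let ?t = "\<lambda>x. g \<otimes>\<^bsub>G\<^esub> x"
  have top: "topspace T = carrier G" and space: "space \<kappa> = carrier G" and sets: "sets \<kappa> = borel_sets T"
    using G \<kappa> by (auto simp: compact_group_def normalized_haar_measure_def)
  have "continuous_map T T ?t"
    using continuous_map_section[of T T T "\<lambda>(x, y). x \<otimes>\<^bsub>G\<^esub> y" g] G g by (simp add: compact_group_def)
  then have t: "?t \<in> measurable \<kappa> \<kappa>"
  proof (intro measurable_sigma_sets[of \<kappa> "topspace T" "{U. openin T U}"])
    show "{U. openin T U} \<subseteq> Pow (topspace T)" using openin_subset by auto
    show "?t \<in> space \<kappa> \<rightarrow> topspace T" using g by (simp add: space top)
    fix U assume c: "continuous_map T T ?t" and "U \<in> {U. openin T U}"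
    then have "openin T {x \<in> topspace T. ?t x \<in> U}" by (auto intro: openin_continuous_map_preimage)
    moreover have "?t -` U \<inter> space \<kappa> = {x \<in> topspace T. ?t x \<in> U}" by (auto simp: space top)
    ultimately show "?t -` U \<inter> space \<kappa> \<in> sets \<kappa>"
      by (auto simp: sets borel_sets_def intro: sigma_sets.Basic)
  qed (simp_all add: sets borel_sets_def)
  have "distr \<kappa> \<kappa> ?t = \<kappa>"
  proof (rule measure_eqI)
    fix U assume "U \<in> sets (distr \<kappa> \<kappa> ?t)"
    then have U: "U \<in> sets \<kappa>" by simp
    then have sub: "U \<subseteq> carrier G" using sets.sets_into_space space by blast
    have "?t -` U \<inter> space \<kappa> = (\<lambda>x. inv\<^bsub>G\<^esub> g \<otimes>\<^bsub>G\<^esub> x) ` U"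
    proof (intro equalityI subsetI)
      fix x assume "x \<in> ?t -` U \<inter> space \<kappa>"
      then have "x \<in> carrier G" "g \<otimes>\<^bsub>G\<^esub> x \<in> U" by (auto simp: space)
      moreover have "inv\<^bsub>G\<^esub> g \<otimes>\<^bsub>G\<^esub> (g \<otimes>\<^bsub>G\<^esub> x) = x" using g calculation by (simp add: m_assoc[symmetric])
      ultimately show "x \<in> (\<lambda>x. inv\<^bsub>G\<^esub> g \<otimes>\<^bsub>G\<^esub> x) ` U" by force
    next
      fix x assume "x \<in> (\<lambda>x. inv\<^bsub>G\<^esub> g \<otimes>\<^bsub>G\<^esub> x) ` U"
      then obtain u where u: "u \<in> U" "x = inv\<^bsub>G\<^esub> g \<otimes>\<^bsub>G\<^esub> u" by blast
      then have "u \<in> carrier G" using sub by blast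
      then show "x \<in> ?t -` U \<inter> space \<kappa>" using u g by (simp add: space m_assoc[symmetric])
    qed
    then show "emeasure (distr \<kappa> \<kappa> ?t) U = emeasure \<kappa> U"
      using \<kappa> g U t by (simp add: emeasure_distr normalized_haar_measure_def)
  qed simp
  then show ?thesis using integral_distr[OF t \<phi>] by simp
qed

lemma continuous_map_borel_measurable:
  assumes "sets M = borel_sets X" "space M = topspace X" "continuous_map X euclidean \<phi>"
  shows "\<phi> \<in> borel_measurable M"
proof (rule borel_measurableI)
  fix U :: "'b set" assume "open U"
  then have "openin X {x \<in> topspace X. \<phi> x \<in> U}"
    using assms(3) by (intro openin_continuous_map_preimage) auto
  moreover have "\<phi> -` U \<inter> space M = {x \<in> topspace X. \<phi> x \<in> U}" using assms(2) by auto
  ultimately show "\<phi> -` U \<inter> space M \<in> sets M"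
    by (auto simp: assms(1) borel_sets_def intro: sigma_sets.Basic)
qed

lemma bounded_functional_haar:
  assumes G: "compact_group G T" and \<kappa>: "normalized_haar_measure G T \<kappa>"
  shows "bounded_functional T 1 (\<lambda>\<phi>. LINT k|\<kappa>. \<phi> k)"
proof -
  have top: "topspace T = space \<kappa>" and sets: "sets \<kappa> = borel_sets T" and one: "emeasure \<kappa> (space \<kappa>) = 1"
    using G \<kappa> by (auto simp: compact_group_def normalized_haar_measure_def)
  have fin: "finite_measure \<kappa>" by (rule finite_measureI) (simp add: one)
  have "bounded_functional T (measure \<kappa> (space \<kappa>)) (\<lambda>\<phi>. LINT x:topspace T|\<kappa>. \<phi> x)"
  proof (rule bounded_functional_set_integral[OF _ fin])
    show "compact_space T" using G by (simp add: compact_group_def)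
    show "topspace T \<in> sets \<kappa>" by (simp add: top)
    fix \<phi> :: "_ \<Rightarrow> complex" assume "continuous_map T euclidean \<phi>"
    then have "\<phi> \<in> borel_measurable \<kappa>"
      by (rule continuous_map_borel_measurable[OF sets top[symmetric]])
    then show "set_borel_measurable \<kappa> (topspace T) \<phi>"
      unfolding set_borel_measurable_def top by simp
  qed
  then show ?thesis
    by (simp add: top set_integral_space measure_def one set_lebesgue_integral_def
        cong: Bochner_Integration.integral_cong)
qed

lemma sums_empty_zero:
  fixes \<nu> :: "'a::topological_space set \<Rightarrow> 'b::real_normed_vector"
  assumes "\<And>A. range A \<subseteq> sets borel \<Longrightarrow> disjoint_family A \<Longrightarrow> (\<lambda>i::nat. \<nu> (A i)) sums \<nu> (\<Union>i. A i)"
  shows "\<nu> {} = 0"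
  using assms[of "\<lambda>_. {}"] summable_const_iff sums_summable by (fastforce simp: disjoint_family_on_def)

lemma countably_additive_Un:
  fixes \<nu> :: "'a::topological_space set \<Rightarrow> 'b::real_normed_vector"
  assumes ca: "\<And>A. range A \<subseteq> sets borel \<Longrightarrow> disjoint_family A \<Longrightarrow> (\<lambda>i::nat. \<nu> (A i)) sums \<nu> (\<Union>i. A i)"
    and X: "X \<in> sets borel" and Y: "Y \<in> sets borel" and d: "X \<inter> Y = {}"
  shows "\<nu> (X \<union> Y) = \<nu> X + \<nu> Y"
proof -
  have "(\<lambda>i. \<nu> (binaryset X Y i)) sums \<nu> (\<Union>i. binaryset X Y i)"
    using X Y d by (intro ca) (auto simp: binaryset_def disjoint_family_on_def)
  moreover have "(\<lambda>i. \<nu> (binaryset X Y i)) sums (\<nu> X + \<nu> Y)"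
    using binaryset_sums[of \<nu> X Y] sums_empty_zero[of \<nu>, OF ca] by simp
  ultimately show ?thesis by (simp add: UN_binaryset_eq sums_unique2)
qed

text \<open>
  Vanishing of \<open>\<mu>\<close> on all Borel subsets is easier to carry through finite unions than vanishing of
  the total variation. For the forward direction, \<open>B\<close> is a member of the partition
  \<open>{B, A - B}\<close> of \<open>A\<close>.
\<close>

lemma total_variation_zero_iff:
  assumes e: "\<mu> {} = 0" and A: "A \<in> sets borel"
  shows "total_variation \<mu> A = 0 \<longleftrightarrow> (\<forall>B\<in>sets borel. B \<subseteq> A \<longrightarrow> \<mu> B = 0)"
proof (intro iffI ballI impI)
  fix B assume z: "total_variation \<mu> A = 0" and B: "B \<in> sets borel" "B \<subseteq> A"
  show "\<mu> B = 0"
  proof (cases "B = {}")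
    case False
    let ?P = "{B, A - B} - {{}}"
    have "partition_on A ?P" using B by (auto simp: partition_on_def disjoint_def)
    then have "(\<Sum>C\<in>?P. ennreal (norm (\<mu> C))) \<le> total_variation \<mu> A"
      unfolding total_variation_def using A B by (intro SUP_upper) auto
    then have "(\<Sum>C\<in>?P. ennreal (norm (\<mu> C))) = 0" using z by simp
    moreover have "B \<in> ?P" using False by simp
    ultimately have "ennreal (norm (\<mu> B)) = 0"
      by (subst (asm) sum_eq_0_iff) auto
    then show ?thesis by simp
  qed (simp add: e)
next
  assume z: "\<forall>B\<in>sets borel. B \<subseteq> A \<longrightarrow> \<mu> B = 0"
  have "(\<Sum>B\<in>P. ennreal (norm (\<mu> B))) = 0" if "P \<subseteq> sets borel" "partition_on A P" for P
  proof (rule sum.neutral, rule ballI)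
    fix B assume "B \<in> P"
    then have "B \<in> sets borel" "B \<subseteq> A" using that partition_onD1[OF that(2)] by auto
    then show "ennreal (norm (\<mu> B)) = 0" using z by simp
  qed
  then have "total_variation \<mu> A \<le> 0"
    unfolding total_variation_def by (intro SUP_least) auto
  then show "total_variation \<mu> A = 0" by simp
qed

text \<open>
  The complement of the support is a union of open null sets, possibly an uncountable one, so
  countable additivity is not enough. A compact subset is covered by finitely many of these sets and
  is therefore null, and inner regularity of the total variation passes this on to the complement.
\<close>

lemma complex_measure_zero_outside_support:
  fixes \<mu> :: "'a::t2_space set \<Rightarrow> complex"
  assumes \<mu>: "complex_measure \<mu>" and B: "B \<in> sets borel" "B \<subseteq> - measure_support \<mu>"
  shows "\<mu> B = 0"
proof -
  have ca: "\<And>A. range A \<subseteq> sets borel \<Longrightarrow> disjoint_family A \<Longrightarrow> (\<lambda>i::nat. \<mu> (A i)) sums \<mu> (\<Union>i. A i)"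
    and reg: "regular euclidean (total_variation \<mu>)"
    using \<mu> by (auto simp: complex_measure_def)
  have e: "\<mu> {} = 0" by (rule sums_empty_zero[OF ca])
  define null where "null W \<longleftrightarrow> W \<in> sets borel \<and> (\<forall>B\<in>sets borel. B \<subseteq> W \<longrightarrow> \<mu> B = 0)" for W
  let ?N = "{W. open W \<and> null W}"
  have U: "- measure_support \<mu> = \<Union>?N"
    by (auto simp: measure_support_def null_def total_variation_zero_iff[where \<mu> = \<mu>, OF e])
  then have "open (- measure_support \<mu>)" by auto
  then have borel: "- measure_support \<mu> \<in> sets borel" by simp
  have null_Un: "null (V \<union> W)" if V: "null V" and W: "null W" for V W
    unfolding null_def
  proof (intro conjI ballI impI)
    show "V \<union> W \<in> sets borel" using V W by (auto simp: null_def)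
    fix B assume B: "B \<in> sets borel" "B \<subseteq> V \<union> W"
    have 1: "B \<inter> V \<in> sets borel" "B - V \<in> sets borel" using B V by (auto simp: null_def)
    have "B = (B \<inter> V) \<union> (B - V)" by auto
    then have "\<mu> B = \<mu> (B \<inter> V) + \<mu> (B - V)"
      using countably_additive_Un[of \<mu>, OF ca 1] by auto
    moreover have "\<mu> (B \<inter> V) = 0" "\<mu> (B - V) = 0"
      using V W 1 B by (auto simp: null_def)
    ultimately show "\<mu> B = 0" by simp
  qed
  have null_Union: "null (\<Union>F)" if "finite F" "F \<subseteq> ?N" for F
    using that
  proof (induction F rule: finite_induct)
    case empty
    show ?case by (simp add: null_def e)
  next
    case (insert V F)
    then have "null V" "null (\<Union>F)" by blast+
    then show ?case unfolding Union_insert by (rule null_Un)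
  qed
  have "total_variation \<mu> C = 0" if C: "compact C" "C \<subseteq> - measure_support \<mu>" for C
  proof -
    obtain F where F: "finite F" "F \<subseteq> ?N" "C \<subseteq> \<Union>F"
    proof (rule compactE[OF C(1)])
      show "C \<subseteq> \<Union>?N" using C(2) U by simp
    qed auto
    have "C \<in> sets borel" using C(1) by (simp add: compact_imp_closed)
    moreover have "\<forall>B\<in>sets borel. B \<subseteq> C \<longrightarrow> \<mu> B = 0"
      using null_Union[OF F(1,2)] F(3) unfolding null_def by blast
    ultimately show ?thesis using total_variation_zero_iff[where \<mu> = \<mu>, OF e] by blast
  qed
  then have "(SUP C\<in>{C. compactin euclidean C \<and> C \<subseteq> - measure_support \<mu>}. total_variation \<mu> C) \<le> 0"
    by (intro SUP_least) auto
  moreover have "total_variation \<mu> (- measure_support \<mu>)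
      = (SUP C\<in>{C. compactin euclidean C \<and> C \<subseteq> - measure_support \<mu>}. total_variation \<mu> C)"
    using reg borel unfolding regular_def borel_sets_euclidean by blast
  ultimately have "total_variation \<mu> (- measure_support \<mu>) = 0"
    by simp
  then show ?thesis using total_variation_zero_iff[where \<mu> = \<mu>, OF e borel] B by blast
qed

text \<open>
  The cut-off by the support turns integration against \<open>\<mu>\<close> into a functional on functions that are
  continuous on the support only. It does not change the integral of a function that is continuous
  everywhere if \<open>\<mu>\<close> is a complex measure with compact support.
\<close>

definition support_integral :: "('a::topological_space set \<Rightarrow> complex) \<Rightarrow> ('a \<Rightarrow> complex) \<Rightarrow> complex" where
  "support_integral \<mu> \<phi> = cm_integral \<mu> (\<lambda>t. indicator (measure_support \<mu>) t *\<^sub>R \<phi> t)"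

lemma sets_upper_variation: "sets (upper_variation \<nu>) = sets borel"
  and space_upper_variation: "space (upper_variation \<nu>) = UNIV"
  using sets.sigma_sets_eq[of borel] by (auto simp: upper_variation_def sets_measure_of_conv space_measure_of_conv)

text \<open>
  The integral against a complex measure is a linear combination of integrals against four upper
  variations, so both properties of the cut-off are proved for one of these.
\<close>

lemma upper_variation_support:
  fixes \<nu> :: "'a::topological_space set \<Rightarrow> real"
  assumes ca: "\<And>A. range A \<subseteq> sets borel \<Longrightarrow> disjoint_family A \<Longrightarrow> (\<lambda>i::nat. \<nu> (A i)) sums \<nu> (\<Union>i. A i)"
    and b: "\<And>A. A \<in> sets borel \<Longrightarrow> \<nu> A \<le> b"
    and S: "compact S" "S \<in> sets borel" and z: "\<And>B. B \<in> sets borel \<Longrightarrow> B \<subseteq> - S \<Longrightarrow> \<nu> B = 0"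
  shows "\<exists>B. bounded_functional (top_of_set S) B (\<lambda>\<phi>. LINT t|upper_variation \<nu>. indicator S t *\<^sub>R \<phi> t)"
    and "continuous_on UNIV \<phi> \<Longrightarrow>
      (LINT t|upper_variation \<nu>. (\<phi> t :: complex)) = (LINT t|upper_variation \<nu>. indicator S t *\<^sub>R \<phi> t)"
proof -
  let ?M = "upper_variation \<nu>"
  note em = emeasure_upper_variation[of \<nu>, OF ca]
  have M: "finite_measure ?M"
  proof (rule finite_measureI)
    have "emeasure ?M UNIV \<le> ennreal b"
      by (subst em) (auto intro!: SUP_least ennreal_leI b)
    then show "emeasure ?M (space ?M) \<noteq> \<infinity>"
      by (auto simp: space_upper_variation top_unique)
  qed
  have "bounded_functional (top_of_set S) (measure ?M (space ?M)) (\<lambda>\<phi>. LINT t:topspace (top_of_set S)|?M. \<phi> t)"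
  proof (rule bounded_functional_set_integral[OF _ M])
    fix \<phi> :: "'a \<Rightarrow> complex" assume "continuous_map (top_of_set S) euclidean \<phi>"
    then show "set_borel_measurable ?M (topspace (top_of_set S)) \<phi>"
      using borel_measurable_continuous_on_indicator[OF S(2)]
      by (simp add: set_borel_measurable_def measurable_cong_sets[OF sets_upper_variation refl])
  qed (use S in \<open>simp_all add: compact_space_subtopology sets_upper_variation\<close>)
  then show "\<exists>B. bounded_functional (top_of_set S) B (\<lambda>\<phi>. LINT t|?M. indicator S t *\<^sub>R \<phi> t)"
    by (auto simp: set_lebesgue_integral_def)
  assume "continuous_on UNIV \<phi>"
  then have m: "\<phi> \<in> borel_measurable ?M"
    by (simp add: measurable_cong_sets[OF sets_upper_variation refl] borel_measurable_continuous_onI)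
  have S': "S \<in> sets ?M" using S(2) by (simp add: sets_upper_variation)
  have "emeasure ?M (- S) = (SUP B\<in>{B \<in> sets borel. B \<subseteq> - S}. ennreal (\<nu> B))"
    using S(2) by (intro em) auto
  also have "\<dots> \<le> 0" using z by (intro SUP_least) auto
  finally have "- S \<in> null_sets ?M" using S(2) by (auto simp: null_sets_def sets_upper_variation)
  then have "AE t in ?M. t \<in> S" by (rule AE_I') auto
  then show "(LINT t|?M. \<phi> t) = (LINT t|?M. indicator S t *\<^sub>R \<phi> t)"
    using m S' by (intro integral_cong_AE) auto
qed

lemma support_integral:
  fixes \<mu> :: "'a::t2_space set \<Rightarrow> complex"
  assumes \<mu>: "complex_measure \<mu>" and S: "compact (measure_support \<mu>)"
  shows "\<exists>B. bounded_functional (top_of_set (measure_support \<mu>)) B (support_integral \<mu>)"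
    and "continuous_on UNIV \<phi> \<Longrightarrow> cm_integral \<mu> \<phi> = support_integral \<mu> \<phi>"
proof -
  let ?S = "measure_support \<mu>"
  let ?I = "\<lambda>\<nu> \<phi>. LINT t|upper_variation \<nu>. indicator ?S t *\<^sub>R (\<phi> t :: complex)"
  have ca: "\<And>A. range A \<subseteq> sets borel \<Longrightarrow> disjoint_family A \<Longrightarrow> (\<lambda>i::nat. \<mu> (A i)) sums \<mu> (\<Union>i. A i)"
    and "bounded (\<mu> ` sets borel)"
    using \<mu> by (auto simp: complex_measure_def)
  then obtain b where b: "\<And>A. A \<in> sets borel \<Longrightarrow> norm (\<mu> A) \<le> b"
    by (auto simp: bounded_iff)
  have Sb: "?S \<in> sets borel" using S by (simp add: compact_imp_closed)
  note z = complex_measure_zero_outside_support[OF \<mu>]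
  have part: "(\<exists>B. bounded_functional (top_of_set ?S) B (?I \<nu>)) \<and>
     (continuous_on UNIV \<phi> \<longrightarrow> (LINT t|upper_variation \<nu>. \<phi> t) = ?I \<nu> \<phi>)"
    if l: "bounded_linear h" and le: "\<And>w. h w \<le> norm w" and \<nu>: "\<nu> = (\<lambda>A. h (\<mu> A))"
    for h :: "complex \<Rightarrow> real" and \<nu>
  proof -
    have 1: "(\<lambda>i::nat. \<nu> (A i)) sums \<nu> (\<Union>i. A i)" if "range A \<subseteq> sets borel" "disjoint_family A" for A
      unfolding \<nu> by (rule bounded_linear.sums[OF l ca[OF that]])
    have 2: "\<nu> A \<le> b" if "A \<in> sets borel" for A
      unfolding \<nu> using le[of "\<mu> A"] b[OF that] by linarith
    have 3: "\<nu> B = 0" if "B \<in> sets borel" "B \<subseteq> - ?S" for B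
      unfolding \<nu> z[OF that] by (rule linear_0[OF bounded_linear.linear[OF l]])
    show ?thesis using upper_variation_support[of \<nu>, OF 1 2 S Sb 3] by blast
  qed
  have h: "bounded_linear Re" "bounded_linear (\<lambda>w. - Re w)" "bounded_linear Im" "bounded_linear (\<lambda>w. - Im w)"
    by (auto intro: bounded_linear_Re bounded_linear_Im bounded_linear_minus)
  have le: "Re w \<le> norm w" "- Re w \<le> norm w" "Im w \<le> norm w" "- Im w \<le> norm w" for w
    using abs_Re_le_cmod[of w] abs_Im_le_cmod[of w] by linarith+
  note parts = part[OF h(1) le(1) refl] part[OF h(2) le(2) refl] part[OF h(3) le(3) refl] part[OF h(4) le(4) refl]
  have eq: "support_integral \<mu> = (\<lambda>\<phi>. (?I (\<lambda>A. Re (\<mu> A)) \<phi> + (-1) * ?I (\<lambda>A. - Re (\<mu> A)) \<phi>)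
       + \<i> * (?I (\<lambda>A. Im (\<mu> A)) \<phi> + (-1) * ?I (\<lambda>A. - Im (\<mu> A)) \<phi>))"
    by (rule ext) (simp add: support_integral_def cm_integral_def)
  show "\<exists>B. bounded_functional (top_of_set ?S) B (support_integral \<mu>)"
  proof -
    obtain B1 B2 B3 B4 where
      B1: "bounded_functional (top_of_set ?S) B1 (?I (\<lambda>A. Re (\<mu> A)))" and
      B2: "bounded_functional (top_of_set ?S) B2 (?I (\<lambda>A. - Re (\<mu> A)))" and
      B3: "bounded_functional (top_of_set ?S) B3 (?I (\<lambda>A. Im (\<mu> A)))" and
      B4: "bounded_functional (top_of_set ?S) B4 (?I (\<lambda>A. - Im (\<mu> A)))"
      using parts by (elim conjE exE)
    note combination = bounded_functional_linear_combination
    from combination[OF combination[OF B1 B2, of "-1"] combination[OF B3 B4, of "-1"], of \<i>]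
    show ?thesis unfolding eq by blast
  qed
  assume "continuous_on UNIV \<phi>"
  then show "cm_integral \<mu> \<phi> = support_integral \<mu> \<phi>"
    using parts unfolding eq by (simp add: cm_integral_def)
qed

section \<open>Stability of the functional equation\<close>

theorem theorem2p2:
  fixes K :: "('a::{topological_group_add, t2_space} \<Rightarrow> 'a) set"
    and T :: "('a \<Rightarrow> 'a) topology"
    and \<kappa> :: "('a \<Rightarrow> 'a) measure"
    and \<mu> :: "'a set \<Rightarrow> complex"
    and \<delta> :: real
    and f g :: "'a \<Rightarrow> complex"
  assumes "locally_compact_space (euclidean :: 'a topology)"
    and "subgroup K Mor"
    and "compact_group (Mor\<lparr>carrier := K\<rparr>) T"
    and "continuous_map (prod_topology T euclidean) euclidean (\<lambda>(k, x). k x)"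
    and "normalized_haar_measure (Mor\<lparr>carrier := K\<rparr>) T \<kappa>"
    and "complex_measure \<mu>"
    and "compact (measure_support \<mu>)"
    and "K_invariant K \<mu>"
    and "\<delta> > 0"
    and "continuous_on UNIV f"
    and "continuous_on UNIV g"
    and "\<And>x y. norm ((LINT k|\<kappa>. cm_integral \<mu> (\<lambda>t. f (x + t + k y))) - f x * g y) < \<delta>"
  shows "(bounded (range f) \<and> bounded (range g))
       \<or> (\<not> bounded (range f) \<and> equation_E \<kappa> \<mu> g)
       \<or> (\<not> bounded (range g)
          \<and> (\<forall>x y. cm_integral \<mu> (\<lambda>t. LINT k|\<kappa>. f (x + t + k y)) = f x * g y)
          \<and> ((\<exists>x. f x \<noteq> 0) \<longrightarrow> equation_E \<kappa> \<mu> g))"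
proof -
  let ?G = "Mor\<lparr>carrier := K\<rparr> :: ('a \<Rightarrow> 'a) monoid"
  have top: "topspace T = K" and space: "space \<kappa> = K" and sets: "sets \<kappa> = borel_sets T"
    and T: "compact_space T" "Hausdorff_space T"
    and mult: "continuous_map (prod_topology T T) T (\<lambda>(k, l). k \<circ> l)"
    using assms(3,5) by (auto simp: compact_group_def normalized_haar_measure_def Mor_def)
  have Mor: "K \<subseteq> carrier Mor" using assms(2) by (simp add: subgroup.subset)
  obtain C where I: "bounded_functional (top_of_set (measure_support \<mu>)) C (support_integral \<mu>)"
    using support_integral(1)[OF assms(6,7)] by blast
  note cm = support_integral(2)[OF assms(6,7)]
  have k_cont: "continuous_on UNIV k" if "k \<in> K" for k
    using that Mor homeomorphic_imp_continuous_map[of euclidean euclidean k] by (auto simp: Mor_def)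
  interpret invariant_average T "measure_support \<mu>" "(\<circ>)" "\<lambda>k. k" "\<lambda>\<phi>. LINT k|\<kappa>. \<phi> k" "support_integral \<mu>" 1 C
  proof
    show "bounded_functional T 1 (\<lambda>\<phi>. LINT k|\<kappa>. \<phi> k)"
      by (rule bounded_functional_haar[OF assms(3,5)])
    show "(\<forall>x y. k (x + y) = k x + k y) \<or> (\<forall>x y. k (x + y) = k y + k x)" if "k \<in> topspace T" for k
      using that Mor by (auto simp: top Mor_def)
    show "continuous_map T T ((\<circ>) k)" if "k \<in> topspace T" for k
      using continuous_map_section[OF mult that] by simp
    show "(LINT l|\<kappa>. \<phi> (k \<circ> l)) = (LINT l|\<kappa>. \<phi> l)"
      if "k \<in> topspace T" "continuous_map T euclidean \<phi>" for k and \<phi> :: "('a \<Rightarrow> 'a) \<Rightarrow> complex"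
      using normalized_haar_measure_shift[OF assms(3,5), of k \<phi>]
        continuous_map_borel_measurable[OF sets _ that(2)] that(1)
      by (simp add: top space Mor_def)
    show "support_integral \<mu> (\<lambda>t. \<psi> (k t)) = support_integral \<mu> \<psi>"
      if "k \<in> topspace T" "continuous_on UNIV \<psi>" for k \<psi>
    proof -
      have "continuous_on UNIV (\<lambda>t. \<psi> (k t))"
        using continuous_on_compose2[OF that(2) k_cont] that(1) by (simp add: top)
      then show ?thesis
        using assms(8) that by (simp add: cm[symmetric] K_invariant_def top)
    qed
  qed (use T assms(4,7) I in \<open>simp_all\<close>)
  have avg: "(LINT k|\<kappa>. cm_integral \<mu> (\<lambda>t. h (x + t + k y))) = average h x y"
    "(LINT k|\<kappa>. cm_integral \<mu> (\<lambda>t. h (k y + t + x))) = P (\<lambda>p. h (fst p y + snd p + x))"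
    if h: "continuous_on UNIV h" for h x y
    unfolding average_def P_def
    by (simp_all add: cm[OF continuous_on_compose2[OF h]] continuous_intros)
  have approx: "norm (average f x y - f x * g y) \<le> \<delta>" for x y
    using assms(12)[of x y] by (simp add: avg[OF assms(10)] less_imp_le)
  show ?thesis
  proof (cases "bounded (range f)")
    case False
    have "equation_E \<kappa> \<mu> g"
      unfolding equation_E_def avg[OF assms(11)]
      using equation_of_unbounded[OF assms(10,11) less_imp_le[OF assms(9)] approx False] by blast
    with False show ?thesis by blast
  next
    case True
    show ?thesis
    proof (cases "\<exists>x. f x \<noteq> 0")
      case True
      with \<open>bounded (range f)\<close> have "bounded (range g)"
        using bounded_factor[OF assms(10) _ _ approx] by blast
      with \<open>bounded (range f)\<close> show ?thesis by blast
    next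
      case False
      then have "f = (\<lambda>_. 0)" by auto
      then have "cm_integral \<mu> (\<lambda>t. LINT k|\<kappa>. f (x + t + k y)) = f x * g y" for x y
        by (simp add: cm_integral_def)
      with False True show ?thesis by blast
    qed
  qed
qed

end
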